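(* For any pointed simplicial set $K$, the map $\alpha:C(K)\to\Omega C(EK)$ is a coalgebra morphism with respect to the (extended) cobar diagonal $\psi_{EK}$ on $\Omega C(EK)$; that is, $\alpha$ preserves augmentations and $(\alpha\otimes\alpha)\circ\Delta_K=\psi_{EK}\circ\alpha$.
   Context: All chain complexes are over $\mathbb Z$ and the Koszul sign convention is used. A pointed simplicial set $K$ has basepoint $k_0\in K_0$; put $k_n=s_0^nk_0$. $C(K)$ denotes normalized chains, augmented by $C(K)\to C( * )\cong\mathbb Z$, with differential $\sum_i(-1)^i\partial_i$ and coproduct $\Delta_K(x)=\sum_{i=0}^n\tilde\partial^{n-i}x\otimes\partial_0^ix$ for $x\in K_n$, where $\tilde\partial^{n-i}=\partial_{i+1}\cdots\partial_n$. Simplicial suspension $EK$: $E_0K=\{b_0\}$; $E_nK$ is the set of pairs $(i,x)$, $i\ge1$, $x\in K_{n-i}$, modulo $(i,k_n)=s_0^{n+i}b_0=:b_{n+i}$. Faces and degeneracies are generated by $\partial_0(1,x)=b_n$ for $x\in K_n$; $\partial_1(1,x)=b_0$ for $x\in K_0$; $\partial_{i+1}(1,x)=(1,\partial_ix)$ for $x\in K_n$, $n>0$; $s_0(i,x)=(i+1,x)$; $s_{i+1}(1,x)=(1,s_ix)$. Cobar construction: for a coaugmented chain coalgebra $C$ with counit $\varepsilon$, $\overline C=\ker\varepsilon$ and $\overline\Delta(c)=\Delta(c)-(c\otimes1+1\otimes c)$, $\Omega C=(T(s^{-1}\overline C),d_\Omega)$ with $d_\Omega=-s^{-1}ds+\mu(s^{-1}\otimes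 s^{-1})\overline\Delta s$ on generators; words are written $[x_1|\cdots|x_n]=s^{-1}x_1\otimes\cdots\otimes s^{-1}x_n$, and the unit is $[\,]$. $\Omega C$ is augmented by sending all words of positive length to $0$. In $C(EK)$ the coaugmentation is given by $b_0$. Map $\alpha:C(K)\to\Omega C(EK)$: $\alpha(k_0)=[\,]$, $\alpha(y-k_0)=[(1,y)]$ for $y\in K_0\setminus\{k_0\}$, $\alpha(x)=[(1,x)]$ for $x\in K_{\ge1}$. Milgram map: $q:\Omega(C\otimes C')\to\Omega C\otimes\Omega C'$ is the algebra map with $q[x\otimes1]=[x]\otimes[\,]$, $q[1\otimes y]=[\,]\otimes[y]$, $q[x\otimes y]=0$ for $x\in\overline C$, $y\in\overline{C'}$. Eilenberg–Zilber data: for simplicial sets $X,Y$, $f:C(X\times Y)\to C(X)\otimes C(Y)$ is $f(x\times y)=\sum_{i=0}^n\tilde\partial^{n-i}x\otimes\partial_0^iy$, and $\nabla:C(X)\otimes C(Y)\to C(X\times Y)$ is $\nabla(x\otimes y)=\sum_{(\mu,\nu)}(-1)^{\epsilon(\mu)}s_{\nu_q}\cdots s_{\nu_1}x\times s_{\mu_p}\cdots s_{\mu_1}y$ ($x\in X_p$, $y\in Y_q$), the sum being over $(p,q)$-shuffles $(\mu,\nu)$ (partitions of $\{0,\dots,p+q-1\}$ into $\mu_1<\cdots<\mu_p$ and $\nu_1<\cdots<\nu_q$), with $\epsilon(\mu)=\sum_i(\mu_i-(i-1))$. The derived operator of $s_{i_1}\cdots s_{i_k}\partial_{j_1}\cdots\partial_{j_l}$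 is $s_{i_1+1}\cdots s_{i_k+1}\partial_{j_1+1}\cdots\partial_{j_l+1}$; this is extended componentwise to products and linearly to formal sums of operators on unnormalized chains, and denoted by a prime. The homotopy $\varphi:C(X\times Y)\to C(X\times Y)$ of degree $+1$ is given by $\varphi_0=0$ and $\varphi_n=-\varphi_{n-1}'+(\nabla f)'s_0$ in degree $n>0$ (computed on unnormalized chains, then passed to normalized chains). Maps $F_k$: take $X=Y=EK$ and let $\Delta$ be the coproduct of $C(EK\times EK)$. $F_0=0$; $F_1$ is $f$ followed by projection to positive degrees and $s^{-1}$; and $F_k=-\sum_{i+j=k}(F_i\otimes F_j)\Delta\varphi:C(EK\times EK)\to T^k\bigl(s^{-1}(C(EK)\otimes C(EK))_+\bigr)$ for $k\ge2$. Extended cobar diagonal: with $\Lambda:EK\to EK\times EK$ the simplicial diagonal, $\xi_K=q\circ\sum_{k\ge1}F_k\circ C(\Lambda)$ (on each simplex of $EK$ only finitely many $F_k\circ C(\Lambda)$ are nonzero), and $\psi_{EK}:\Omega C(EK)\to\Omega C(EK)\otimes\Omega C(EK)$ is the algebra map with $\psi_{EK}[(1,x)]=\xi_K((1,x))$. *)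

theory Defs
  imports "HOL-Library.Poly_Mapping"
begin

section \<open>Simplicial sets\<close>

text \<open>A simplicial set is a graded set of simplices with face and degeneracy operators.
  The set of \<open>n\<close>-simplices is \<open>{x \<in> smp X. sdim X x = n}\<close>; the operators are only
  meaningful on \<open>smp X\<close> and for indices in the usual range.\<close>

record 'a sset =
  smp :: "'a set"
  sdim :: "'a \<Rightarrow> nat"
  sface :: "nat \<Rightarrow> 'a \<Rightarrow> 'a"
  sdegen :: "nat \<Rightarrow> 'a \<Rightarrow> 'a"

locale simplicial_set =
  fixes X :: "'a sset"
  assumes face_closed: "\<lbrakk>x \<in> smp X; 0 < sdim X x; i \<le> sdim X x\<rbrakk> \<Longrightarrow> sface X i x \<in> smp X"
    and face_dim: "\<lbrakk>x \<in> smp X; 0 < sdim X x; i \<le> sdim X x\<rbrakk>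
          \<Longrightarrow> sdim X (sface X i x) = sdim X x - 1"
    and degen_closed: "\<lbrakk>x \<in> smp X; i \<le> sdim X x\<rbrakk> \<Longrightarrow> sdegen X i x \<in> smp X"
    and degen_dim: "\<lbrakk>x \<in> smp X; i \<le> sdim X x\<rbrakk> \<Longrightarrow> sdim X (sdegen X i x) = sdim X x + 1"
    and face_face: "\<lbrakk>x \<in> smp X; 2 \<le> sdim X x; i < j; j \<le> sdim X x\<rbrakk>
          \<Longrightarrow> sface X i (sface X j x) = sface X (j - 1) (sface X i x)"
    and face_degen_less: "\<lbrakk>x \<in> smp X; i < j; j \<le> sdim X x\<rbrakk>
          \<Longrightarrow> sface X i (sdegen X j x) = sdegen X (j - 1) (sface X i x)"
    and face_degen_id: "\<lbrakk>x \<in> smp X; j \<le> sdim X x; i = j \<or> i = j + 1\<rbrakk>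
          \<Longrightarrow> sface X i (sdegen X j x) = x"
    and face_degen_greater: "\<lbrakk>x \<in> smp X; j + 1 < i; i \<le> sdim X x + 1\<rbrakk>
          \<Longrightarrow> sface X i (sdegen X j x) = sdegen X j (sface X (i - 1) x)"
    and degen_degen: "\<lbrakk>x \<in> smp X; i \<le> j; j \<le> sdim X x\<rbrakk>
          \<Longrightarrow> sdegen X i (sdegen X j x) = sdegen X (j + 1) (sdegen X i x)"

locale pointed_simplicial_set = simplicial_set K for K :: "'a sset" +
  fixes k0 :: 'a
  assumes base_in: "k0 \<in> smp K"
    and base_dim: "sdim K k0 = 0"

definition base_simplex :: "'a sset \<Rightarrow> 'a \<Rightarrow> nat \<Rightarrow> 'a" where
  "base_simplex K k0 n = (sdegen K 0 ^^ n) k0"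

definition nondegenerate :: "'a sset \<Rightarrow> 'a set" where
  "nondegenerate X = {x \<in> smp X. \<not> (\<exists>y\<in>smp X. \<exists>i\<le>sdim X y. x = sdegen X i y)}"

definition sset_prod :: "'a sset \<Rightarrow> 'b sset \<Rightarrow> ('a \<times> 'b) sset" where
  "sset_prod X Y =
     \<lparr>smp = {(x, y). x \<in> smp X \<and> y \<in> smp Y \<and> sdim X x = sdim Y y},
      sdim = (\<lambda>(x, y). sdim X x),
      sface = (\<lambda>i (x, y). (sface X i x, sface Y i y)),
      sdegen = (\<lambda>i (x, y). (sdegen X i x, sdegen Y i y))\<rparr>"


subsection \<open>The suspension\<close>

text \<open>Normal forms for the quotient defining \<open>EK\<close>: \<open>Base m\<close> is \<open>b\<^sub>m\<close>, and \<open>Susp i x\<close> is the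
  class of \<open>(i, x)\<close> for \<open>i \<ge> 1\<close> and \<open>x\<close> not an iterated degeneracy of the basepoint.
  The class of an arbitrary pair \<open>(i, x)\<close> is \<open>susp_class K k0 i x\<close>.\<close>

datatype 'a susp = Base nat | Susp nat 'a

definition susp_class :: "'a sset \<Rightarrow> 'a \<Rightarrow> nat \<Rightarrow> 'a \<Rightarrow> 'a susp" where
  "susp_class K k0 i x =
     (if x = base_simplex K k0 (sdim K x) then Base (i + sdim K x) else Susp i x)"

fun susp_dim :: "'a sset \<Rightarrow> 'a susp \<Rightarrow> nat" where
  "susp_dim K (Base m) = m"
| "susp_dim K (Susp i x) = i + sdim K x"

fun susp_up :: "'a susp \<Rightarrow> 'a susp" where
  "susp_up (Base m) = Base (m + 1)"
| "susp_up (Susp i x) = Susp (i + 1) x"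

text \<open>Here \<open>susp_up\<close> is \<open>s\<^sub>0\<close>. The equations for \<open>(i + 2, x) = s\<^sub>0 (i + 1, x)\<close> are forced by
  the simplicial identities \<open>\<partial>\<^sub>0 s\<^sub>0 = \<partial>\<^sub>1 s\<^sub>0 = id\<close>, \<open>\<partial>\<^sub>j s\<^sub>0 = s\<^sub>0 \<partial>\<^sub>j\<^sub>-\<^sub>1\<close> for \<open>j \<ge> 2\<close> and
  \<open>s\<^sub>j s\<^sub>0 = s\<^sub>0 s\<^sub>j\<^sub>-\<^sub>1\<close> for \<open>j \<ge> 1\<close>. Terms \<open>Susp 0 x\<close> do not represent simplices.\<close>

fun susp_face :: "'a sset \<Rightarrow> 'a \<Rightarrow> nat \<Rightarrow> 'a susp \<Rightarrow> 'a susp" where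
  "susp_face K k0 j (Base m) = Base (m - 1)"
| "susp_face K k0 j (Susp 0 x) = undefined"
| "susp_face K k0 j (Susp (Suc 0) x) =
     (if j = 0 then Base (sdim K x)
      else if sdim K x = 0 then Base 0
      else susp_class K k0 1 (sface K (j - 1) x))"
| "susp_face K k0 j (Susp (Suc (Suc i)) x) =
     (if j \<le> 1 then Susp (Suc i) x else susp_up (susp_face K k0 (j - 1) (Susp (Suc i) x)))"

fun susp_degen :: "'a sset \<Rightarrow> 'a \<Rightarrow> nat \<Rightarrow> 'a susp \<Rightarrow> 'a susp" where
  "susp_degen K k0 j (Base m) = Base (m + 1)"
| "susp_degen K k0 j (Susp 0 x) = undefined"
| "susp_degen K k0 j (Susp (Suc 0) x) =
     (if j = 0 then Susp 2 x else susp_class K k0 1 (sdegen K (j - 1) x))"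
| "susp_degen K k0 j (Susp (Suc (Suc i)) x) =
     (if j = 0 then Susp (Suc (Suc (Suc i))) x
      else susp_up (susp_degen K k0 (j - 1) (Susp (Suc i) x)))"

definition suspension :: "'a sset \<Rightarrow> 'a \<Rightarrow> 'a susp sset" where
  "suspension K k0 =
     \<lparr>smp = range Base \<union> {susp_class K k0 i x | i x. 1 \<le> i \<and> x \<in> smp K},
      sdim = susp_dim K,
      sface = susp_face K k0,
      sdegen = susp_degen K k0\<rparr>"


section \<open>Simplicial operators\<close>

text \<open>A word of operators is written as in the composite, so its last entry is applied first.\<close>

datatype sop = Face nat | Degen nat

fun sop_apply :: "'a sset \<Rightarrow> sop \<Rightarrow> 'a \<Rightarrow> 'a" where
  "sop_apply X (Face i) = sface X i"
| "sop_apply X (Degen i) = sdegen X i"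

definition word_apply :: "'a sset \<Rightarrow> sop list \<Rightarrow> 'a \<Rightarrow> 'a" where
  "word_apply X w x = foldr (sop_apply X) w x"

fun sop_derived :: "sop \<Rightarrow> sop" where
  "sop_derived (Face i) = Face (i + 1)"
| "sop_derived (Degen i) = Degen (i + 1)"

definition front_word :: "nat \<Rightarrow> nat \<Rightarrow> sop list" where
  "front_word n i = map Face [i + 1..<n + 1]"

definition back_word :: "nat \<Rightarrow> sop list" where
  "back_word i = replicate i (Face 0)"

definition degen_word :: "nat set \<Rightarrow> sop list" where
  "degen_word N = map Degen (rev (sorted_list_of_set N))"


section \<open>Chains\<close>

text \<open>Free abelian groups are \<open>_ \<Rightarrow>\<^sub>0 int\<close>. The normalized chain group (chains modulo the
  span of the degenerate simplices) is the free abelian group on the nondegenerate simplices, and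
  \<open>normalize\<close> is the quotient map, which sends degenerate simplices to 0.
  Tensor products of free groups are free on pairs of basis elements.\<close>

definition normalized_chains :: "'a sset \<Rightarrow> ('a \<Rightarrow>\<^sub>0 int) set" where
  "normalized_chains X = {c. Poly_Mapping.keys c \<subseteq> nondegenerate X}"

definition normalize :: "'a sset \<Rightarrow> ('a \<Rightarrow>\<^sub>0 int) \<Rightarrow> ('a \<Rightarrow>\<^sub>0 int)" where
  "normalize X = frag_extend (\<lambda>x. if x \<in> nondegenerate X then frag_of x else 0)"

definition chain_aug :: "'a sset \<Rightarrow> ('a \<Rightarrow>\<^sub>0 int) \<Rightarrow> int" where
  "chain_aug X c =
     (\<Sum>x\<in>Poly_Mapping.keys c. if sdim X x = 0 then Poly_Mapping.lookup c x else 0)"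

definition tens :: "('a \<Rightarrow>\<^sub>0 int) \<Rightarrow> ('b \<Rightarrow>\<^sub>0 int) \<Rightarrow> ('a \<times> 'b \<Rightarrow>\<^sub>0 int)" where
  "tens a b = frag_extend (\<lambda>x. frag_extend (\<lambda>y. frag_of (x, y)) b) a"

text \<open>The tensor product of two maps of degree 0.\<close>

definition tens_map ::
  "(('a \<Rightarrow>\<^sub>0 int) \<Rightarrow> ('c \<Rightarrow>\<^sub>0 int)) \<Rightarrow> (('b \<Rightarrow>\<^sub>0 int) \<Rightarrow> ('d \<Rightarrow>\<^sub>0 int))
     \<Rightarrow> ('a \<times> 'b \<Rightarrow>\<^sub>0 int) \<Rightarrow> ('c \<times> 'd \<Rightarrow>\<^sub>0 int)" where
  "tens_map g h = frag_extend (\<lambda>(x, y). tens (g (frag_of x)) (h (frag_of y)))"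

definition alexander_whitney ::
  "'a sset \<Rightarrow> 'b sset \<Rightarrow> ('a \<times> 'b \<Rightarrow>\<^sub>0 int) \<Rightarrow> ('a \<times> 'b \<Rightarrow>\<^sub>0 int)" where
  "alexander_whitney X Y =
     frag_extend (\<lambda>(x, y). \<Sum>i=0..sdim X x.
       tens (normalize X (frag_of (word_apply X (front_word (sdim X x) i) x)))
            (normalize Y (frag_of (word_apply Y (back_word i) y))))"

definition coproduct :: "'a sset \<Rightarrow> ('a \<Rightarrow>\<^sub>0 int) \<Rightarrow> ('a \<times> 'a \<Rightarrow>\<^sub>0 int)" where
  "coproduct X =
     frag_extend (\<lambda>x. \<Sum>i=0..sdim X x.
       tens (normalize X (frag_of (word_apply X (front_word (sdim X x) i) x)))
            (normalize X (frag_of (word_apply X (back_word i) x))))"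

definition chain_diag :: "'a sset \<Rightarrow> ('a \<Rightarrow>\<^sub>0 int) \<Rightarrow> ('a \<times> 'a \<Rightarrow>\<^sub>0 int)" where
  "chain_diag X = frag_extend (\<lambda>x. normalize (sset_prod X X) (frag_of (x, x)))"


section \<open>The Eilenberg--Zilber homotopy\<close>

text \<open>Formal integer combinations of pairs \<open>(u, v)\<close> of operator words, where \<open>u \<times> v\<close> acts on
  \<open>X \<times> Y\<close>. A shuffle is given by its set of \<open>\<mu>\<close>'s; the \<open>\<nu>\<close>'s form the complement.\<close>

type_synonym formal_op = "sop list \<times> sop list \<Rightarrow>\<^sub>0 int"

definition shuffle_sets :: "nat \<Rightarrow> nat \<Rightarrow> nat set set" where
  "shuffle_sets p q = {M. M \<subseteq> {..<p + q} \<and> card M = p}"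

text \<open>With 0-based list positions, \<open>\<mu>\<^sub>i - (i - 1)\<close> is the entry at position \<open>i - 1\<close>
  minus that position.\<close>

definition shuffle_eps :: "nat set \<Rightarrow> nat" where
  "shuffle_eps M = (\<Sum>i<card M. sorted_list_of_set M ! i - i)"

definition nabla_ops :: "nat \<Rightarrow> nat \<Rightarrow> formal_op" where
  "nabla_ops p q =
     (\<Sum>M\<in>shuffle_sets p q. frag_cmul ((-1) ^ shuffle_eps M)
        (frag_of (degen_word ({..<p + q} - M), degen_word M)))"

definition precompose :: "formal_op \<Rightarrow> sop list \<Rightarrow> sop list \<Rightarrow> formal_op" where
  "precompose c u v = frag_extend (\<lambda>(u', v'). frag_of (u' @ u, v' @ v)) c"

definition derived :: "formal_op \<Rightarrow> formal_op" where
  "derived = frag_extend (\<lambda>(u, v). frag_of (map sop_derived u, map sop_derived v))"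

definition nabla_f_ops :: "nat \<Rightarrow> formal_op" where
  "nabla_f_ops n = (\<Sum>i=0..n. precompose (nabla_ops i (n - i)) (front_word n i) (back_word i))"

fun phi_ops :: "nat \<Rightarrow> formal_op" where
  "phi_ops 0 = 0"
| "phi_ops (Suc n) =
     - derived (phi_ops n) + precompose (derived (nabla_f_ops (Suc n))) [Degen 0] [Degen 0]"

definition phi :: "'a sset \<Rightarrow> 'b sset \<Rightarrow> ('a \<times> 'b \<Rightarrow>\<^sub>0 int) \<Rightarrow> ('a \<times> 'b \<Rightarrow>\<^sub>0 int)" where
  "phi X Y = frag_extend (\<lambda>(x, y).
     normalize (sset_prod X Y)
       (frag_extend (\<lambda>(u, v). frag_of (word_apply X u x, word_apply Y v y))
         (phi_ops (sdim X x))))"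


section \<open>Cobar constructions\<close>

text \<open>As an algebra, the cobar construction is the tensor algebra, with basis the words in a
  basis of the desuspended kernel of the counit. The coalgebras \<open>C(EK)\<close> and
  \<open>C(EK) \<otimes> C(EK)\<close> are \<open>\<int>\<close> in degree 0, so this basis consists of the basis elements of
  positive degree. A word \<open>[x\<^sub>1|\<dots>|x\<^sub>n]\<close> is the list of its letters.\<close>

definition cobar :: "'a sset \<Rightarrow> ('a list \<Rightarrow>\<^sub>0 int) set" where
  "cobar X =
     {c. \<forall>w\<in>Poly_Mapping.keys c. set w \<subseteq> {x \<in> nondegenerate X. 0 < sdim X x}}"

definition cobar_aug :: "('a list \<Rightarrow>\<^sub>0 int) \<Rightarrow> int" where
  "cobar_aug c = Poly_Mapping.lookup c []"

definition word_mult :: "('a list \<Rightarrow>\<^sub>0 int) \<Rightarrow> ('a list \<Rightarrow>\<^sub>0 int) \<Rightarrow> ('a list \<Rightarrow>\<^sub>0 int)" where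
  "word_mult a b = frag_extend (\<lambda>(v, w). frag_of (v @ w)) (tens a b)"

definition word_deg :: "'a sset \<Rightarrow> 'a list \<Rightarrow> nat" where
  "word_deg X w = (\<Sum>x\<leftarrow>w. sdim X x - 1)"

text \<open>The product of \<open>\<Omega>C(X) \<otimes> \<Omega>C(X)\<close>, with its Koszul sign.\<close>

definition cobar2_mult ::
  "'a sset \<Rightarrow> ('a list \<times> 'a list \<Rightarrow>\<^sub>0 int) \<Rightarrow> ('a list \<times> 'a list \<Rightarrow>\<^sub>0 int)
     \<Rightarrow> ('a list \<times> 'a list \<Rightarrow>\<^sub>0 int)" where
  "cobar2_mult X a b =
     frag_extend (\<lambda>((v, w), (v', w')).
       frag_cmul ((-1) ^ (word_deg X w * word_deg X v')) (frag_of (v @ v', w @ w'))) (tens a b)"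

text \<open>The algebra map from a tensor algebra to \<open>\<Omega>C(X) \<otimes> \<Omega>C(X)\<close> with given values on letters.\<close>

definition algebra_map ::
  "'a sset \<Rightarrow> ('l \<Rightarrow> ('a list \<times> 'a list \<Rightarrow>\<^sub>0 int))
     \<Rightarrow> ('l list \<Rightarrow>\<^sub>0 int) \<Rightarrow> ('a list \<times> 'a list \<Rightarrow>\<^sub>0 int)" where
  "algebra_map X g =
     frag_extend (\<lambda>w. foldr (\<lambda>l. cobar2_mult X (g l)) w (frag_of ([], [])))"

text \<open>The letters of \<open>\<Omega>(C(X) \<otimes> C(X))\<close> are pairs of nondegenerate simplices that do not both
  have dimension 0; the coaugmentation is given by \<open>b\<close>.\<close>

definition milgram ::
  "'a sset \<Rightarrow> 'a \<Rightarrow> (('a \<times> 'a) list \<Rightarrow>\<^sub>0 int) \<Rightarrow> ('a list \<times> 'a list \<Rightarrow>\<^sub>0 int)" where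
  "milgram X b = algebra_map X (\<lambda>(x, y).
     if y = b then frag_of ([x], []) else if x = b then frag_of ([], [y]) else 0)"

text \<open>In the recursion the range \<open>1 \<le> i < k\<close> suffices because \<open>F\<^sub>0 = 0\<close>, and the sign
  \<open>(-1)\<^bsup>|z|\<^esup>\<close> is the Koszul sign of \<open>F\<^sub>i \<otimes> F\<^sub>j\<close> at \<open>z \<otimes> z'\<close>, as \<open>F\<^sub>j\<close> has degree \<open>-1\<close>.\<close>

fun F_map :: "'a sset \<Rightarrow> nat \<Rightarrow> ('a \<times> 'a \<Rightarrow>\<^sub>0 int) \<Rightarrow> (('a \<times> 'a) list \<Rightarrow>\<^sub>0 int)" where
  "F_map X k c =
     (if k = 0 then 0
      else if k = 1 then
        frag_extend (\<lambda>(x, y). if 0 < sdim X x + sdim X y then frag_of [(x, y)] else 0)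
          (alexander_whitney X X c)
      else - (\<Sum>i\<in>{1..<k}.
        frag_extend (\<lambda>(z, z'). frag_cmul ((-1) ^ sdim (sset_prod X X) z)
            (word_mult (F_map X i (frag_of z)) (F_map X (k - i) (frag_of z'))))
          (coproduct (sset_prod X X) (phi X X c))))"

declare F_map.simps [simp del]


section \<open>The extended cobar diagonal and the map alpha\<close>

text \<open>The \<open>F\<^sub>k\<close> are evaluated on the chain \<open>C(\<Lambda>)(c)\<close>, where only finitely many of them are
  nonzero; the sum runs over those \<open>k\<close>.\<close>

definition xi :: "'a sset \<Rightarrow> 'a \<Rightarrow> ('a susp \<Rightarrow>\<^sub>0 int) \<Rightarrow> ('a susp list \<times> 'a susp list \<Rightarrow>\<^sub>0 int)" where
  "xi K k0 c =
     (let E = suspension K k0; d = chain_diag E c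
      in milgram E (Base 0) (\<Sum>k\<in>{k. 1 \<le> k \<and> F_map E k d \<noteq> 0}. F_map E k d))"

text \<open>Every nondegenerate simplex of \<open>EK\<close> of positive dimension is of the form \<open>(1, x)\<close>.\<close>

definition psi ::
  "'a sset \<Rightarrow> 'a \<Rightarrow> ('a susp list \<Rightarrow>\<^sub>0 int) \<Rightarrow> ('a susp list \<times> 'a susp list \<Rightarrow>\<^sub>0 int)" where
  "psi K k0 = algebra_map (suspension K k0) (\<lambda>e. xi K k0 (frag_of e))"

text \<open>On a vertex \<open>y \<noteq> k0\<close> the value is \<open>\<alpha>(y - k0) + \<alpha>(k0) = [(1, y)] + []\<close>.\<close>

definition alpha :: "'a sset \<Rightarrow> 'a \<Rightarrow> ('a \<Rightarrow>\<^sub>0 int) \<Rightarrow> ('a susp list \<Rightarrow>\<^sub>0 int)" where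
  "alpha K k0 = frag_extend (\<lambda>x.
     if x = k0 then frag_of []
     else if sdim K x = 0 then frag_of [susp_class K k0 1 x] + frag_of []
     else frag_of [susp_class K k0 1 x])"

end

theory Submission
  imports Defs
begin

text \<open>
  A simplex \<open>(i, x)\<close> of \<open>EK\<close> is a simplex \<open>x\<close> of \<open>K\<close> preceded by \<open>i\<close> copies of the cone point, the
  tips; once all tips are deleted, only a degeneracy of the basepoint is left. So every iterated
  face \<open>\<partial>\<^sub>0\<^sup>p\<close> of a simplex with a single tip is trivial for \<open>p \<ge> 1\<close>. Fix a nondegenerate
  \<open>x \<noteq> k0\<close> of dimension \<open>n\<close> and let \<open>e = (1, x)\<close>; all that has to be computed is \<open>F\<^sub>k (e \<times> e)\<close>.

  For \<open>k = 1\<close> only the two extreme terms of the Alexander--Whitney map survive; they give the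
  primitive part \<open>[e] \<otimes> [] + [] \<otimes> [e]\<close>. For \<open>k \<ge> 2\<close> every term of \<open>\<Delta>\<phi>(e \<times> e)\<close> is a cut of a pair
  \<open>z \<times> w\<close> at some vertex, and almost all cuts vanish:

  \<^item> The derived operators in \<open>-\<phi>'\<close> leave the tip of \<open>e\<close> alone, so \<open>z\<close> and \<open>w\<close> have a single tip,
    and the back part of every cut with \<open>p \<ge> 1\<close> is a pair of basepoints. The front part of the
    cut at \<open>p = 0\<close> is a pair of basepoints, too, and all \<open>F\<^sub>k\<close> are 0 there (lemma
    \<open>F_split_single_tip\<close>).
  \<^item> In \<open>(\<nabla>f)'s\<^sub>0\<close> the \<open>i\<close>-th summand of \<open>f\<close> with \<open>i \<ge> 1\<close> deletes the second tip of the second factor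
    again, whereas the first factor keeps it (for \<open>i = 0\<close> the pair \<open>z \<times> w\<close> is degenerate). The
    degeneracies of the shuffle then act on both. If one of them hits the part of \<open>z\<close> that lies in
    \<open>K\<close>, the back faces of \<open>z\<close> are degenerate or trivial; otherwise the shuffle is the one that puts
    all degeneracies of \<open>z\<close> first, and only the cut at the last tip of \<open>z\<close> survives (lemmas
    \<open>degens_cone\<close> and \<open>F_split_shuffle_word\<close>).

  At that cut both halves have a basepoint factor: they are \<open>b \<times> (1, \<partial>\<^sub>0\<^sup>i x)\<close> and
  \<open>(1, \<partial>\<^sub>i\<^sub>+\<^sub>1 \<dots> \<partial>\<^sub>n x) \<times> b\<close>. Now \<open>F\<^sub>k\<close> with \<open>k \<ge> 2\<close> is 0 on pairs with a basepoint factor, because every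
  term of \<open>\<phi>\<close> applies a degeneracy last in both factors, and the basepoint factor shares the one of
  the other factor (lemmas \<open>keys_phi_ops\<close> and \<open>F_map_Base_higher\<close>). Hence \<open>F\<^sub>k (e \<times> e) = 0\<close> for \<open>k \<ge> 3\<close>, and \<open>F\<^sub>2 (e \<times> e)\<close> is a signed sum of the words
  \<open>[b \<otimes> (1, \<partial>\<^sub>0\<^sup>i x) | (1, \<partial>\<^sub>i\<^sub>+\<^sub>1 \<dots> \<partial>\<^sub>n x) \<otimes> b]\<close>. The Milgram map turns such a word into
  \<open>[(1, \<partial>\<^sub>i\<^sub>+\<^sub>1 \<dots> \<partial>\<^sub>n x)] \<otimes> [(1, \<partial>\<^sub>0\<^sup>i x)]\<close>, and its Koszul sign cancels the sign of the shuffle and the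
  signs of the recursion. This is the sum \<open>\<Sum> [(1, _)] \<otimes> [(1, _)]\<close> over the coproduct of \<open>x\<close>. The
  primitive part of \<open>\<xi>\<close> is accounted for by the vertices: on a vertex \<open>\<alpha>\<close> has the extra summand
  \<open>[]\<close>, and the first and the last term of the coproduct of \<open>x\<close> contain a vertex.
\<close>

section \<open>Words of simplicial operators\<close>

lemma word_apply_simps [simp]:
  "word_apply X [] x = x"
  "word_apply X (s # w) x = sop_apply X s (word_apply X w x)"
  "word_apply X (v @ w) x = word_apply X v (word_apply X w x)"
  by (simp_all add: word_apply_def)

text \<open>\<open>op_word n w m\<close> says that \<open>w\<close> is a legitimate operator from dimension \<open>n\<close> to dimension \<open>m\<close>.
  The axioms of a simplicial set say nothing about indices out of range, so every use of a
  simplicial identity needs such a bound.\<close>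

inductive op_word :: "nat \<Rightarrow> sop list \<Rightarrow> nat \<Rightarrow> bool" for n where
  op_word_Nil: "op_word n [] n"
| op_word_Face: "\<lbrakk>op_word n w (Suc m); i \<le> Suc m\<rbrakk> \<Longrightarrow> op_word n (Face i # w) m"
| op_word_Degen: "\<lbrakk>op_word n w m; i \<le> m\<rbrakk> \<Longrightarrow> op_word n (Degen i # w) (Suc m)"

lemma op_word_append: "op_word m v l \<Longrightarrow> op_word n w m \<Longrightarrow> op_word n (v @ w) l"
  by (induction rule: op_word.induct) (auto intro: op_word.intros)

lemma op_word_derived: "op_word n w m \<Longrightarrow> op_word (Suc n) (map sop_derived w) (Suc m)"
  by (induction rule: op_word.induct) (auto intro: op_word.intros)

lemma front_word_self [simp]: "front_word n n = []"
  by (simp add: front_word_def)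

lemma front_word_less: "i < n \<Longrightarrow> front_word n i = Face (Suc i) # front_word n (Suc i)"
  by (simp add: front_word_def upt_conv_Cons del: upt_Suc)

lemma op_word_front: "i \<le> n \<Longrightarrow> op_word n (front_word n i) i"
  by (induction i rule: inc_induct) (auto simp: front_word_less intro: op_word.intros)

lemma op_word_back: "i \<le> n \<Longrightarrow> op_word n (back_word i) (n - i)"
proof (induction i)
  case (Suc i)
  then have "op_word n (Face 0 # back_word i) (n - Suc i)"
    by (intro op_word_Face) (auto simp: Suc_diff_Suc)
  then show ?case by (simp add: back_word_def)
qed (simp add: back_word_def op_word_Nil)

text \<open>As the indices increase strictly and the last one is in range for the last step, each one is
  in range for its own step.\<close>

lemma op_word_degen_list:
  "\<lbrakk>sorted_wrt (<) vs; \<forall>v\<in>set vs. v < n + length vs\<rbrakk>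
    \<Longrightarrow> op_word n (map Degen (rev vs)) (n + length vs)"
proof (induction vs rule: rev_induct)
  case (snoc v vs)
  then have "op_word n (map Degen (rev vs)) (n + length vs)"
    by (intro snoc.IH) (fastforce simp: sorted_wrt_append)+
  then show ?case using snoc.prems by (auto intro: op_word_Degen)
qed (simp add: op_word_Nil)

lemma op_word_degen:
  assumes "N \<subseteq> {..<n + card N}"
  shows "op_word n (degen_word N) (n + card N)"
proof -
  have "finite N" using assms finite_subset by blast
  then show ?thesis
    using op_word_degen_list[of "sorted_list_of_set N" n] assms
    by (auto simp: degen_word_def)
qed

lemma (in simplicial_set) op_word_apply:
  assumes "op_word n w m" "x \<in> smp X" "sdim X x = n"
  shows "word_apply X w x \<in> smp X" "sdim X (word_apply X w x) = m"
proof -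
  have "word_apply X w x \<in> smp X \<and> sdim X (word_apply X w x) = m"
    using assms by (induction rule: op_word.induct) (auto simp: face_closed face_dim degen_closed degen_dim)
  then show "word_apply X w x \<in> smp X" "sdim X (word_apply X w x) = m" by auto
qed

lemma degen_not_nondegenerate:
  "\<lbrakk>y \<in> smp X; i \<le> sdim X y\<rbrakk> \<Longrightarrow> sdegen X i y \<notin> nondegenerate X"
  by (auto simp: nondegenerate_def)

lemma nondegenerate_simplex: "x \<in> nondegenerate X \<Longrightarrow> x \<in> smp X"
  by (simp add: nondegenerate_def)

lemma sset_prod_simps [simp]:
  "(x, y) \<in> smp (sset_prod X Y) \<longleftrightarrow> x \<in> smp X \<and> y \<in> smp Y \<and> sdim X x = sdim Y y"
  "sdim (sset_prod X Y) (x, y) = sdim X x"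
  "sface (sset_prod X Y) i (x, y) = (sface X i x, sface Y i y)"
  "sdegen (sset_prod X Y) i (x, y) = (sdegen X i x, sdegen Y i y)"
  by (auto simp: sset_prod_def)

lemma word_apply_sset_prod [simp]:
  "word_apply (sset_prod X Y) w (x, y) = (word_apply X w x, word_apply Y w y)"
proof (induction w)
  case (Cons s w)
  then show ?case by (cases s) auto
qed auto

context simplicial_set
begin

lemma front_degen:
  assumes "x \<in> smp X" "sdim X x = d" "j < p" "p \<le> Suc d"
  shows "word_apply X (front_word (Suc d) p) (sdegen X j x)
    = sdegen X j (word_apply X (front_word d (p - 1)) x)"
  using assms(4,3)
proof (induction p rule: inc_induct)
  case base
  then show ?case by simp
next
  case (step p)
  let ?y = "word_apply X (front_word d p) x"
  have y: "?y \<in> smp X" "sdim X ?y = p"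
    using op_word_apply[OF op_word_front] assms step by auto
  have "front_word d (p - 1) = Face p # front_word d p"
    using front_word_less[of "p - 1" d] step by auto
  then show ?case
    using step face_degen_greater[OF y(1), of j "Suc p"] y by (simp add: front_word_less)
qed

lemma back_degen:
  assumes "x \<in> smp X" "p \<le> j" "j \<le> sdim X x"
  shows "word_apply X (back_word p) (sdegen X j x)
    = sdegen X (j - p) (word_apply X (back_word p) x)"
  using assms(2)
proof (induction p)
  case 0
  then show ?case by (simp add: back_word_def)
next
  case (Suc p)
  let ?y = "word_apply X (back_word p) x"
  have y: "?y \<in> smp X" "sdim X ?y = sdim X x - p"
    using op_word_apply[OF op_word_back[of p "sdim X x"]] assms Suc by auto
  show ?case
    using Suc face_degen_less[OF y(1), of 0 "j - p"] y assms by (simp add: back_word_def)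
qed

end

text \<open>A common degeneracy \<open>s\<^sub>j\<close> of \<open>z\<close> and \<open>w\<close> falls on one side of the vertex \<open>p\<close>: if \<open>j < p\<close>, the front
  face of \<open>w\<close> inherits it, and otherwise the back face of \<open>z\<close> does.\<close>

lemma nondegenerate_prodI:
  assumes "simplicial_set X" "simplicial_set Y"
    and zw: "z \<in> smp X" "w \<in> smp Y" "sdim X z = d" "sdim Y w = d" "p \<le> d"
    and bck: "word_apply X (back_word p) z \<in> nondegenerate X"
    and frt: "word_apply Y (front_word d p) w \<in> nondegenerate Y"
  shows "(z, w) \<in> nondegenerate (sset_prod X Y)"
proof (rule ccontr)
  interpret X: simplicial_set X by fact
  interpret Y: simplicial_set Y by fact
  assume "\<not> ?thesis"
  then obtain a b j where ab: "a \<in> smp X" "b \<in> smp Y" "sdim X a = sdim Y b" "j \<le> sdim X a"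
    "z = sdegen X j a" "w = sdegen Y j b"
    using zw unfolding nondegenerate_def by auto
  then have d: "d = Suc (sdim X a)" using zw X.degen_dim by auto
  show False
  proof (cases "j < p")
    case True
    then have *: "word_apply Y (front_word d p) w
        = sdegen Y j (word_apply Y (front_word (sdim X a) (p - 1)) b)"
      using Y.front_degen[of b "sdim X a" j p] ab zw d by auto
    have "op_word (sdim Y b) (front_word (sdim X a) (p - 1)) (p - 1)"
      using op_word_front[of "p - 1" "sdim Y b"] ab d zw by auto
    from Y.op_word_apply[OF this ab(2)] True show False
      using frt unfolding * by (auto simp: degen_not_nondegenerate)
  next
    case False
    then have *: "word_apply X (back_word p) z
        = sdegen X (j - p) (word_apply X (back_word p) a)"
      using X.back_degen[of a p j] ab by auto
    have "op_word (sdim X a) (back_word p) (sdim X a - p)"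
      using op_word_back[of p "sdim X a"] False ab by auto
    from X.op_word_apply[OF this ab(1)] False ab show False
      using bck unfolding * by (auto simp: degen_not_nondegenerate)
  qed
qed

lemma (in simplicial_set) front_degen_cancel:
  assumes "x \<in> smp X" "sdim X x = p"
  shows "word_apply X (front_word (p + l) p) (word_apply X (map Degen (rev [p..<p + l])) x) = x"
proof (induction l)
  case (Suc l)
  let ?y = "word_apply X (map Degen (rev [p..<p + l])) x"
  have "op_word p (map Degen (rev [p..<p + l])) (p + l)"
    using op_word_degen_list[of "[p..<p + l]" p] by simp
  from op_word_apply[OF this assms]
  have "sface X (Suc (p + l)) (sdegen X (p + l) ?y) = ?y"
    by (intro face_degen_id) auto
  moreover have "front_word (p + Suc l) p = front_word (p + l) p @ [Face (Suc (p + l))]"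
    by (simp add: front_word_def)
  ultimately show ?case using Suc by simp
qed simp

section \<open>The Eilenberg--Zilber homotopy as a sum over shuffles\<close>

lemma frag_extend_frag_extend:
  "frag_extend g (frag_extend h c) = frag_extend (\<lambda>x. frag_extend g (h x)) c"
proof -
  have "Poly_Mapping.keys c \<subseteq> UNIV" by simp
  then show ?thesis
    by (induction c rule: frag_induction) (auto simp: frag_extend_diff)
qed

lemma finite_shuffle_sets: "finite (shuffle_sets p q)"
  unfolding shuffle_sets_def by (rule finite_subset[of _ "Pow {..<p + q}"]) auto

lemma shuffle_eps_segment: "shuffle_eps {m..<m + i} = i * m"
  by (simp add: shuffle_eps_def)

text \<open>The two words of a term of \<open>\<phi>\<close> both apply a degeneracy last, though not with the same index.
  This is what makes \<open>\<phi>\<close> vanish as soon as one of the two simplices is a degenerate basepoint.\<close>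

definition outer_degens :: "nat \<Rightarrow> (sop list \<times> sop list) set" where
  "outer_degens n = {(Degen a # u, Degen b # v) | a b u v.
     op_word n (Degen a # u) (Suc n) \<and> op_word n (Degen b # v) (Suc n)}"

lemma degen_word_empty [simp]: "degen_word {} = []"
  by (simp add: degen_word_def)

lemma degen_word_nonempty:
  assumes "finite N" "N \<noteq> {}"
  obtains a w where "degen_word N = Degen a # w"
proof -
  have "rev (sorted_list_of_set N) \<noteq> []" using assms by simp
  then show ?thesis using that unfolding degen_word_def
    by (metis list.simps(9) neq_Nil_conv)
qed

text \<open>The term of \<open>(\<nabla>f)' s\<^sub>0\<close> that belongs to the \<open>i\<close>-th summand of \<open>f\<close> and the shuffle \<open>M\<close>.\<close>

definition shuffle_word :: "nat \<Rightarrow> nat \<Rightarrow> nat set \<Rightarrow> sop list \<times> sop list" where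
  "shuffle_word n i M =
     (map sop_derived (degen_word ({..<n} - M) @ front_word n i) @ [Degen 0],
      map sop_derived (degen_word M @ back_word i) @ [Degen 0])"

lemma phi_ops_Suc_expand:
  "phi_ops (Suc n) = - derived (phi_ops n)
     + (\<Sum>i=0..Suc n. \<Sum>M\<in>shuffle_sets i (Suc n - i).
          frag_cmul ((-1) ^ shuffle_eps M) (frag_of (shuffle_word (Suc n) i M)))"
proof -
  have "precompose (derived (nabla_f_ops (Suc n))) [Degen 0] [Degen 0] =
     (\<Sum>i=0..Suc n. \<Sum>M\<in>shuffle_sets i (Suc n - i).
          frag_cmul ((-1) ^ shuffle_eps M) (frag_of (shuffle_word (Suc n) i M)))"
    unfolding nabla_f_ops_def derived_def precompose_def nabla_ops_def
    by (auto simp: frag_extend_sum finite_shuffle_sets frag_extend_cmul shuffle_word_def simp del: sum.cl_ivl_Suc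
        intro!: sum.cong)
  then show ?thesis by simp
qed

text \<open>The first factor is degenerated by the complement of \<open>M\<close> and the second one by \<open>M\<close>. If that set
  is empty, \<open>f\<close> does not apply any face to the factor, so its outermost operator is the derived
  \<open>s\<^sub>0\<close>.\<close>

lemma shuffle_word_outer_degens:
  assumes "M \<in> shuffle_sets i (n - i)" "i \<le> n"
  shows "shuffle_word n i M \<in> outer_degens n"
proof -
  have M: "M \<subseteq> {..<n}" "card M = i" "finite M"
    using assms finite_subset by (auto simp: shuffle_sets_def)
  then have card: "card ({..<n} - M) = n - i" by (simp add: card_Diff_subset)
  define u where "u = map sop_derived (degen_word ({..<n} - M) @ front_word n i) @ [Degen 0]"
  define v where "v = map sop_derived (degen_word M @ back_word i) @ [Degen 0]"
  have "op_word i (degen_word ({..<n} - M)) n"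
    using op_word_degen[of "{..<n} - M" i] card assms by auto
  then have u: "op_word n u (Suc n)" unfolding u_def
    by (intro op_word_append[of "Suc n"] op_word_derived op_word_append[of i] op_word_front assms)
      (auto intro: op_word.intros)
  have "op_word (n - i) (degen_word M) n"
    using op_word_degen[of M "n - i"] M assms by auto
  then have v: "op_word n v (Suc n)" unfolding v_def
    by (intro op_word_append[of "Suc n"] op_word_derived op_word_append[of "n - i"] op_word_back assms)
      (auto intro: op_word.intros)
  have "\<exists>a u'. u = Degen a # u'"
  proof (cases "i = n")
    case True
    then have e: "{..<n} - M = {}" using M card by (simp add: card_eq_0_iff)
    show ?thesis unfolding u_def e using True by simp
  next
    case False
    then have "{..<n} - M \<noteq> {}" using card assms(2) by force
    then obtain a w where "degen_word ({..<n} - M) = Degen a # w"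
      using degen_word_nonempty[of "{..<n} - M"] by blast
    then show ?thesis by (simp add: u_def)
  qed
  moreover have "\<exists>b v'. v = Degen b # v'"
  proof (cases "M = {}")
    case True
    then show ?thesis using M by (simp add: v_def back_word_def)
  next
    case False
    then obtain a w where "degen_word M = Degen a # w"
      using degen_word_nonempty[of M] M by blast
    then show ?thesis by (simp add: v_def)
  qed
  ultimately show ?thesis using u v
    unfolding shuffle_word_def u_def[symmetric] v_def[symmetric] outer_degens_def by auto
qed

lemma keys_derived:
  "Poly_Mapping.keys (derived c) \<subseteq> map_prod (map sop_derived) (map sop_derived) ` Poly_Mapping.keys c"
  unfolding derived_def
  by (rule order.trans[OF keys_frag_extend]) (auto simp: keys_frag_of intro: rev_image_eqI)

text \<open>Deriving raises the indices and keeps the shape of a word, so the property passes from one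
  degree to the next.\<close>

lemma keys_phi_ops: "Poly_Mapping.keys (phi_ops n) \<subseteq> outer_degens n"
proof (induction n)
  case (Suc n)
  have "Poly_Mapping.keys (derived (phi_ops n)) \<subseteq> outer_degens (Suc n)"
  proof
    fix uv assume "uv \<in> Poly_Mapping.keys (derived (phi_ops n))"
    then obtain u v where "(u, v) \<in> outer_degens n" "uv = (map sop_derived u, map sop_derived v)"
      using keys_derived Suc by fastforce
    then show "uv \<in> outer_degens (Suc n)"
      unfolding outer_degens_def using op_word_derived[of n u "Suc n"] op_word_derived[of n v "Suc n"]
      by auto
  qed
  moreover have "Poly_Mapping.keys (\<Sum>i=0..Suc n. \<Sum>M\<in>shuffle_sets i (Suc n - i).
          frag_cmul ((-1) ^ shuffle_eps M) (frag_of (shuffle_word (Suc n) i M))) \<subseteq> outer_degens (Suc n)"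
    (is "Poly_Mapping.keys ?m \<subseteq> _")
  proof
    fix uv assume "uv \<in> Poly_Mapping.keys ?m"
    then obtain i where i: "i \<in> {0..Suc n}" and "uv \<in> Poly_Mapping.keys (\<Sum>M\<in>shuffle_sets i (Suc n - i).
          frag_cmul ((-1) ^ shuffle_eps M) (frag_of (shuffle_word (Suc n) i M)))"
      by (blast dest: subsetD[OF keys_sum])
    then obtain M where "M \<in> shuffle_sets i (Suc n - i)" "uv = shuffle_word (Suc n) i M"
      by (auto dest!: subsetD[OF keys_sum] simp: keys_frag_of)
    then show "uv \<in> outer_degens (Suc n)"
      using shuffle_word_outer_degens i by auto
  qed
  ultimately show ?case
    unfolding phi_ops_Suc_expand using keys_add[of "- derived (phi_ops n)" ?m] unfolding keys_minus
    by blast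
qed simp

section \<open>Chains and the recursion for the twisting maps\<close>

lemma normalize_frag_of:
  "normalize X (frag_of x) = (if x \<in> nondegenerate X then frag_of x else 0)"
  by (simp add: normalize_def)

lemma tens_frag_of [simp]: "tens (frag_of x) (frag_of y) = frag_of (x, y)"
  by (simp add: tens_def)

lemma tens_0 [simp]: "tens 0 b = 0" "tens a 0 = 0"
  by (auto simp: tens_def intro!: frag_extend_eq_0)

lemma coproduct_frag_of:
  "coproduct X (frag_of x) = (\<Sum>p=0..sdim X x.
     let a = word_apply X (front_word (sdim X x) p) x; b = word_apply X (back_word p) x
     in if a \<in> nondegenerate X \<and> b \<in> nondegenerate X then frag_of (a, b) else 0)"
  unfolding coproduct_def by (auto simp: normalize_frag_of Let_def intro!: sum.cong)

lemma alexander_whitney_frag_of: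
  "alexander_whitney X Y (frag_of (x, y)) = (\<Sum>p=0..sdim X x.
     let a = word_apply X (front_word (sdim X x) p) x; b = word_apply Y (back_word p) y
     in if a \<in> nondegenerate X \<and> b \<in> nondegenerate Y then frag_of (a, b) else 0)"
  unfolding alexander_whitney_def by (auto simp: normalize_frag_of Let_def intro!: sum.cong)

definition F_tensor ::
  "'a sset \<Rightarrow> nat \<Rightarrow> nat \<Rightarrow> (('a \<times> 'a) \<times> ('a \<times> 'a) \<Rightarrow>\<^sub>0 int) \<Rightarrow> (('a \<times> 'a) list \<Rightarrow>\<^sub>0 int)"
  where
  "F_tensor X i j = frag_extend (\<lambda>(z, z').
     frag_cmul ((-1) ^ sdim (sset_prod X X) z)
       (word_mult (F_map X i (frag_of z)) (F_map X j (frag_of z'))))"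

text \<open>One summand of the recursion for \<open>F\<close>, as a function of a single pair that occurs in \<open>\<phi>\<close>. As \<open>\<phi>\<close>
  has values in normalized chains, degenerate pairs are sent to 0.\<close>

definition F_split :: "'a sset \<Rightarrow> nat \<Rightarrow> nat \<Rightarrow> 'a \<times> 'a \<Rightarrow> (('a \<times> 'a) list \<Rightarrow>\<^sub>0 int)" where
  "F_split X i j z =
     F_tensor X i j (coproduct (sset_prod X X) (normalize (sset_prod X X) (frag_of z)))"

lemma F_map_0: "F_map X 0 c = 0"
  by (subst F_map.simps) simp

lemma F_map_1:
  "F_map X (Suc 0) c = frag_extend
     (\<lambda>(x, y). if 0 < sdim X x + sdim X y then frag_of [(x, y)] else 0) (alexander_whitney X X c)"
  by (subst F_map.simps) simp

lemma F_map_rec: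
  assumes "2 \<le> k"
  shows "F_map X k (frag_of (x, y)) = - (\<Sum>i\<in>{1..<k}. frag_extend
     (\<lambda>(u, v). F_split X i (k - i) (word_apply X u x, word_apply X v y)) (phi_ops (sdim X x)))"
proof -
  have "F_map X k (frag_of (x, y)) = - (\<Sum>i\<in>{1..<k}. F_tensor X i (k - i)
     (coproduct (sset_prod X X) (phi X X (frag_of (x, y)))))"
    using assms by (subst F_map.simps) (simp add: F_tensor_def)
  also have "\<dots> = - (\<Sum>i\<in>{1..<k}. frag_extend
     (\<lambda>(u, v). F_split X i (k - i) (word_apply X u x, word_apply X v y)) (phi_ops (sdim X x)))"
    unfolding phi_def F_split_def F_tensor_def coproduct_def normalize_def frag_extend_of prod.case
      frag_extend_frag_extend
    by (simp add: split_def)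
  finally show ?thesis .
qed

lemma F_split_0:
  assumes "z \<notin> nondegenerate (sset_prod X X)"
  shows "F_split X i j z = 0"
  using assms by (simp add: F_split_def normalize_frag_of coproduct_def F_tensor_def)

lemma F_split_nondegenerate:
  assumes "(z, w) \<in> nondegenerate (sset_prod X X)"
  shows "F_split X i j (z, w) = (\<Sum>p=0..sdim X z.
     let a = (word_apply X (front_word (sdim X z) p) z, word_apply X (front_word (sdim X z) p) w);
         b = (word_apply X (back_word p) z, word_apply X (back_word p) w)
     in if a \<in> nondegenerate (sset_prod X X) \<and> b \<in> nondegenerate (sset_prod X X)
        then frag_cmul ((-1) ^ sdim X (fst a)) (word_mult (F_map X i (frag_of a)) (F_map X j (frag_of b)))
        else 0)"
  using assms
  by (auto simp: F_split_def normalize_frag_of coproduct_frag_of F_tensor_def frag_extend_sum Let_def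
      simp del: sum.cl_ivl_Suc intro!: sum.cong)

lemma word_mult_0 [simp]: "word_mult 0 b = 0" "word_mult a 0 = 0"
  by (simp_all add: word_mult_def)

lemma word_mult_frag_of [simp]: "word_mult (frag_of v) (frag_of w) = frag_of (v @ w)"
  by (simp add: word_mult_def)

section \<open>Algebra of cobar constructions\<close>

lemma word_deg_single [simp]: "word_deg X [x] = sdim X x - 1"
  by (simp add: word_deg_def)

lemma cobar2_mult_frag_of:
  "cobar2_mult X (frag_of (v, w)) (frag_of (v', w'))
    = frag_cmul ((-1) ^ (word_deg X w * word_deg X v')) (frag_of (v @ v', w @ w'))"
  by (simp add: cobar2_mult_def)

lemma cobar2_mult_unit [simp]: "cobar2_mult X a (frag_of ([], [])) = a"
proof -
  have "Poly_Mapping.keys a \<subseteq> UNIV" by simp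
  then show ?thesis
    by (induction a rule: frag_induction)
      (auto simp: cobar2_mult_frag_of word_deg_def, auto simp: cobar2_mult_def tens_def frag_extend_diff)
qed

lemma algebra_map_Nil: "algebra_map X g (frag_of []) = frag_of ([], [])"
  by (simp add: algebra_map_def)

lemma tens_add:
  "tens (a + b) c = tens a c + tens b c" "tens a (b + c) = tens a b + tens a c"
proof -
  show "tens (a + b) c = tens a c + tens b c" by (simp add: tens_def frag_extend_add)
  have "Poly_Mapping.keys a \<subseteq> UNIV" by simp
  then show "tens a (b + c) = tens a b + tens a c"
    by (induction a rule: frag_induction) (auto simp: tens_def frag_extend_add frag_extend_diff)
qed

lemma tens_map_tens: "tens_map g h (tens (frag_of x) (frag_of y)) = tens (g (frag_of x)) (h (frag_of y))"
  by (simp add: tens_map_def)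

text \<open>Linearity of the augmentation is hidden by its sum over the support; a common finite superset of
  the supports makes it visible.\<close>

lemma chain_aug_superset:
  assumes "finite A" "Poly_Mapping.keys c \<subseteq> A"
  shows "chain_aug X c = (\<Sum>x\<in>A. if sdim X x = 0 then Poly_Mapping.lookup c x else 0)"
  unfolding chain_aug_def
  using assms by (intro sum.mono_neutral_left) (auto simp: in_keys_iff)

lemma chain_aug_diff: "chain_aug X (a - b) = chain_aug X a - chain_aug X b"
proof -
  let ?A = "Poly_Mapping.keys a \<union> Poly_Mapping.keys b"
  have "finite ?A" by simp
  then show ?thesis
    using keys_diff[of a b]
    by (simp add: chain_aug_superset[of ?A] lookup_minus if_distrib flip: sum_subtractf cong: if_cong)
qed

section \<open>The suspension as a simplicial set\<close>

context pointed_simplicial_set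
begin

abbreviation ksusp :: "'a susp sset" where
  "ksusp \<equiv> suspension K k0"

text \<open>The class of \<open>(i, x)\<close>: the simplex \<open>x\<close> of the cone over \<open>K\<close> with \<open>i\<close> tips in front.\<close>

abbreviation cone :: "nat \<Rightarrow> 'a \<Rightarrow> 'a susp" where
  "cone \<equiv> susp_class K k0"

lemma base_simplex_simplex:
  "base_simplex K k0 n \<in> smp K" "sdim K (base_simplex K k0 n) = n"
proof -
  have "base_simplex K k0 n \<in> smp K \<and> sdim K (base_simplex K k0 n) = n"
    by (induction n) (auto simp: base_simplex_def base_in base_dim degen_closed degen_dim)
  then show "base_simplex K k0 n \<in> smp K" "sdim K (base_simplex K k0 n) = n" by auto
qed

lemma base_simplex_Suc: "base_simplex K k0 (Suc n) = sdegen K 0 (base_simplex K k0 n)"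
  by (simp add: base_simplex_def)

lemma degen_base_simplex:
  "j \<le> n \<Longrightarrow> sdegen K j (base_simplex K k0 n) = base_simplex K k0 (Suc n)"
proof (induction n arbitrary: j)
  case 0
  then show ?case by (simp add: base_simplex_Suc)
next
  case (Suc n)
  show ?case
  proof (cases j)
    case 0
    then show ?thesis by (simp add: base_simplex_Suc)
  next
    case (Suc i)
    then have "sdegen K j (sdegen K 0 (base_simplex K k0 n))
        = sdegen K 0 (sdegen K i (base_simplex K k0 n))"
      using degen_degen[of "base_simplex K k0 n" 0 i] Suc.prems base_simplex_simplex by auto
    then show ?thesis using Suc.IH[of i] Suc.prems Suc by (simp add: base_simplex_Suc)
  qed
qed

lemma face_base_simplex:
  "j \<le> Suc n \<Longrightarrow> sface K j (base_simplex K k0 (Suc n)) = base_simplex K k0 n"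
proof (induction n arbitrary: j)
  case 0
  then show ?case
    using face_degen_id[of "base_simplex K k0 0" 0 j] base_simplex_simplex[of 0]
    by (cases j) (auto simp: base_simplex_Suc)
next
  case (Suc n)
  show ?case
  proof (cases "j \<le> 1")
    case True
    then show ?thesis
      using face_degen_id[of "base_simplex K k0 (Suc n)" 0 j] base_simplex_simplex[of "Suc n"]
      by (cases j) (auto simp: base_simplex_Suc[of "Suc n"])
  next
    case False
    then have "sface K j (base_simplex K k0 (Suc (Suc n)))
        = sdegen K 0 (sface K (j - 1) (base_simplex K k0 (Suc n)))"
      using face_degen_greater[of "base_simplex K k0 (Suc n)" 0 j] Suc.prems base_simplex_simplex[of "Suc n"]
      by (auto simp: base_simplex_Suc[of "Suc n"])
    then show ?thesis using Suc.IH[of "j - 1"] Suc.prems by (simp add: base_simplex_Suc)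
  qed
qed

lemma dim_cone: "susp_dim K (cone i x) = i + sdim K x"
  by (simp add: susp_class_def)

text \<open>The operators of \<open>EK\<close> are defined by recursion on the number of tips. This lemma and the next
  ones resolve the recursion: operators with an index below the number of tips act on the tips, all
  others act on \<open>x\<close>. The degeneracies of the basepoint obey the same rules, so the two normal forms
  of a simplex need not be distinguished afterwards.\<close>

lemma degen_cone_tip:
  assumes "1 \<le> i" "j < i"
  shows "susp_degen K k0 j (cone i x) = cone (Suc i) x"
  using assms
proof (induction i arbitrary: j rule: dec_induct)
  case base
  then show ?case by (simp add: susp_class_def numeral_2_eq_2)
next
  case (step n)
  obtain m where m: "n = Suc m" using step.hyps by (cases n) auto
  show ?case using step.IH[of "j - 1"] step.prems m
    by (cases "x = base_simplex K k0 (sdim K x)") (auto simp: susp_class_def)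
qed

lemma degen_cone:
  assumes "1 \<le> i" and x: "x \<in> smp K" and j: "j \<le> sdim K x"
  shows "susp_degen K k0 (i + j) (cone i x) = cone i (sdegen K j x)"
proof (cases "x = base_simplex K k0 (sdim K x)")
  case True
  then have "sdegen K j x = base_simplex K k0 (Suc (sdim K x))"
    using degen_base_simplex[OF j] by simp
  then show ?thesis using True
    by (simp add: susp_class_def base_simplex_simplex)
next
  case False
  show ?thesis using assms(1)
  proof (induction i rule: dec_induct)
    case base
    then show ?case using False by (simp add: susp_class_def)
  next
    case (step n)
    obtain m where m: "n = Suc m" using step.hyps by (cases n) auto
    show ?case using step.IH False
      by (auto simp: susp_class_def m split: if_splits)
  qed
qed

lemma face_cone_tip:
  assumes "1 \<le> i" "j < i"
  shows "susp_face K k0 j (cone i x) = (if i = 1 then Base (sdim K x) else cone (i - 1) x)"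
  using assms
proof (induction i arbitrary: j rule: dec_induct)
  case base
  then show ?case by (simp add: susp_class_def)
next
  case (step n)
  obtain m where m: "n = Suc m" using step.hyps by (cases n) auto
  show ?case using step.IH[of "j - 1"] step.prems m
    by (cases "x = base_simplex K k0 (sdim K x)"; cases m) (auto simp: susp_class_def)
qed

lemma face_cone:
  assumes "1 \<le> i" and x: "x \<in> smp K" and j: "j \<le> sdim K x"
  shows "susp_face K k0 (i + j) (cone i x)
    = (if sdim K x = 0 then Base (i - 1) else cone i (sface K j x))"
proof (cases "x = base_simplex K k0 (sdim K x)")
  case True
  show ?thesis
  proof (cases "sdim K x")
    case 0
    then show ?thesis using True by (simp add: susp_class_def)
  next
    case (Suc n)
    then have "sface K j x = base_simplex K k0 n"
      using face_base_simplex[of j n] j True by simp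
    then show ?thesis using True Suc
      by (simp add: susp_class_def base_simplex_simplex)
  qed
next
  case False
  show ?thesis using assms(1)
  proof (induction i rule: dec_induct)
    case base
    then show ?case using False by (simp add: susp_class_def)
  next
    case (step n)
    obtain m where m: "n = Suc m" using step.hyps by (cases n) auto
    show ?case using step.IH False
      by (auto simp: susp_class_def m split: if_splits)
  qed
qed

lemma suspension_simps [simp]:
  "sdim ksusp = susp_dim K" "sface ksusp = susp_face K k0" "sdegen ksusp = susp_degen K k0"
  "Base m \<in> smp ksusp" "\<lbrakk>1 \<le> i; x \<in> smp K\<rbrakk> \<Longrightarrow> cone i x \<in> smp ksusp"
  by (auto simp: suspension_def)

lemma suspension_cases:
  assumes "u \<in> smp ksusp"
  obtains m where "u = Base m" | i x where "1 \<le> i" "x \<in> smp K" "u = cone i x"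
  using assms by (auto simp: suspension_def)

lemma degen_cone_cases:
  assumes "1 \<le> i" "x \<in> smp K" "j \<le> i + sdim K x"
  shows "susp_degen K k0 j (cone i x)
    = (if j < i then cone (Suc i) x else cone i (sdegen K (j - i) x))"
  using degen_cone[OF assms(1,2), of "j - i"] degen_cone_tip[OF assms(1)] assms(3) by auto

lemma face_cone_cases:
  assumes "1 \<le> i" "x \<in> smp K" "j \<le> i + sdim K x"
  shows "susp_face K k0 j (cone i x)
    = (if j < i then if i = 1 then Base (sdim K x) else cone (i - 1) x
       else if sdim K x = 0 then Base (i - 1) else cone i (sface K (j - i) x))"
  using face_cone[OF assms(1,2), of "j - i"] face_cone_tip[OF assms(1)] assms(3) by auto

text \<open>In terms of tips each simplicial identity either is one of \<open>K\<close>, with shifted indices, or concerns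
  operators of which one only changes the number of tips.\<close>

theorem simplicial_set_suspension: "simplicial_set ksusp"
proof
  fix u i j
  { assume u: "u \<in> smp ksusp" "0 < sdim ksusp u" "i \<le> sdim ksusp u"
    show "sface ksusp i u \<in> smp ksusp"
      by (rule suspension_cases[OF u(1)]) (use u in \<open>auto simp: face_cone_cases dim_cone face_closed\<close>)
    show "sdim ksusp (sface ksusp i u) = sdim ksusp u - 1"
      by (rule suspension_cases[OF u(1)]) (use u in \<open>auto simp: face_cone_cases dim_cone face_dim\<close>) }
  { assume u: "u \<in> smp ksusp" "i \<le> sdim ksusp u"
    show "sdegen ksusp i u \<in> smp ksusp"
      by (rule suspension_cases[OF u(1)]) (use u in \<open>auto simp: degen_cone_cases dim_cone degen_closed\<close>)
    show "sdim ksusp (sdegen ksusp i u) = sdim ksusp u + 1"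
      by (rule suspension_cases[OF u(1)]) (use u in \<open>auto simp: degen_cone_cases dim_cone degen_dim\<close>) }
  { assume u: "u \<in> smp ksusp" "2 \<le> sdim ksusp u" "i < j" "j \<le> sdim ksusp u"
    show "sface ksusp i (sface ksusp j u) = sface ksusp (j - 1) (sface ksusp i u)"
    proof (rule suspension_cases[OF u(1)])
      fix a x assume ax: "1 \<le> a" "x \<in> smp K" "u = cone a x"
      consider "j < a" | "i < a" "a \<le> j" "sdim K x = 0" | "i < a" "a \<le> j" "sdim K x \<noteq> 0"
        | "a \<le> i" "sdim K x = 1" | "a \<le> i" "2 \<le> sdim K x"
        using u ax by (fastforce simp: dim_cone)
      then show ?thesis
      proof cases
        case 5
        then show ?thesis using ax u face_face[of x "i - a" "j - a"]
          by (auto simp: face_cone_cases dim_cone face_closed face_dim diff_le_mono Suc_diff_le)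
      qed (use u ax in \<open>auto simp: face_cone_cases dim_cone face_closed face_dim\<close>)
    qed auto }
  { assume u: "u \<in> smp ksusp" "i < j" "j \<le> sdim ksusp u"
    show "sface ksusp i (sdegen ksusp j u) = sdegen ksusp (j - 1) (sface ksusp i u)"
    proof (rule suspension_cases[OF u(1)])
      fix a x assume ax: "1 \<le> a" "x \<in> smp K" "u = cone a x"
      show ?thesis using ax u face_degen_less[of x "i - a" "j - a"]
        by (auto simp: face_cone_cases degen_cone_cases dim_cone face_closed face_dim degen_closed degen_dim)
    qed (use u in auto) }
  { assume u: "u \<in> smp ksusp" "j \<le> sdim ksusp u" "i = j \<or> i = j + 1"
    show "sface ksusp i (sdegen ksusp j u) = u"
    proof (rule suspension_cases[OF u(1)])
      fix a x assume ax: "1 \<le> a" "x \<in> smp K" "u = cone a x"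
      show ?thesis using ax u face_degen_id[of x "j - a" "i - a"]
        by (auto simp: face_cone_cases degen_cone_cases dim_cone face_closed face_dim degen_closed degen_dim Suc_diff_le)
    qed auto }
  { assume u: "u \<in> smp ksusp" "j + 1 < i" "i \<le> sdim ksusp u + 1"
    show "sface ksusp i (sdegen ksusp j u) = sdegen ksusp j (sface ksusp (i - 1) u)"
    proof (rule suspension_cases[OF u(1)])
      fix a x assume ax: "1 \<le> a" "x \<in> smp K" "u = cone a x"
      show ?thesis using ax u face_degen_greater[of x "j - a" "i - a"]
        by (auto simp: face_cone_cases degen_cone_cases dim_cone face_closed face_dim degen_closed degen_dim Suc_diff_le)
    qed (use u in auto) }
  { assume u: "u \<in> smp ksusp" "i \<le> j" "j \<le> sdim ksusp u"
    show "sdegen ksusp i (sdegen ksusp j u) = sdegen ksusp (j + 1) (sdegen ksusp i u)"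
    proof (rule suspension_cases[OF u(1)])
      fix a x assume ax: "1 \<le> a" "x \<in> smp K" "u = cone a x"
      show ?thesis using ax u degen_degen[of x "i - a" "j - a"]
        by (auto simp: degen_cone_cases dim_cone degen_closed degen_dim Suc_diff_le)
    qed auto }
qed

interpretation E: simplicial_set ksusp
  by (rule simplicial_set_suspension)

section \<open>Nondegenerate simplices and faces of the suspension\<close>

lemma Base_nondegenerate: "Base m \<in> nondegenerate ksusp \<longleftrightarrow> m = 0"
proof
  assume m: "Base m \<in> nondegenerate ksusp"
  show "m = 0"
  proof (rule ccontr)
    assume "m \<noteq> 0"
    then have "Base m = sdegen ksusp 0 (Base (m - 1))" by simp
    then show False using m degen_not_nondegenerate[of "Base (m - 1)" ksusp 0] by simp
  qed
next
  assume "m = 0"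
  moreover have "sdegen ksusp i y \<noteq> Base 0" if "y \<in> smp ksusp" "i \<le> sdim ksusp y" for i y
    using E.degen_dim[OF that] by auto
  ultimately show "Base m \<in> nondegenerate ksusp"
    by (fastforce simp: nondegenerate_def)
qed

lemma cone_degenerate:
  assumes "x \<in> smp K" "i \<ge> 2"
  shows "cone i x \<notin> nondegenerate ksusp"
proof -
  have "cone i x = sdegen ksusp 0 (cone (i - 1) x)"
    using degen_cone_tip[of "i - 1" 0 x] assms by simp
  then show ?thesis using degen_not_nondegenerate[of "cone (i - 1) x" ksusp 0] assms by simp
qed

lemma cone_degen_degenerate:
  assumes "x \<in> smp K" "j \<le> sdim K x" "1 \<le> i"
  shows "cone i (sdegen K j x) \<notin> nondegenerate ksusp"
  using degen_cone[OF assms(3,1,2)] degen_not_nondegenerate[of "cone i x" ksusp "i + j"] assms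
  by (simp add: dim_cone)

lemma simplex_cases:
  assumes "x \<in> smp K"
  obtains "x \<in> nondegenerate K" | y j where "y \<in> smp K" "j \<le> sdim K y" "x = sdegen K j y"
  using assms by (auto simp: nondegenerate_def)

lemma base_simplex_nondegenerate:
  assumes "x \<in> nondegenerate K"
  shows "x = base_simplex K k0 (sdim K x) \<longleftrightarrow> x = k0"
proof (cases "sdim K x")
  case 0
  then show ?thesis by (simp add: base_simplex_def)
next
  case (Suc n)
  then show ?thesis
    using assms degen_not_nondegenerate[of "base_simplex K k0 n" K 0] base_simplex_simplex[of n] base_dim
    by (auto simp: base_simplex_Suc)
qed

lemma cone_nondegenerate_eq:
  assumes "x \<in> nondegenerate K" "x \<noteq> k0"
  shows "cone i x = Susp i x"
  using base_simplex_nondegenerate assms by (auto simp: susp_class_def)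

text \<open>A degeneracy with exactly one tip can only come from a degeneracy in \<open>K\<close>, and \<open>(1, k0)\<close> is the
  degenerate edge at the basepoint.\<close>

lemma cone_1_nondegenerate:
  assumes x: "x \<in> smp K"
  shows "cone 1 x \<in> nondegenerate ksusp \<longleftrightarrow> x \<in> nondegenerate K \<and> x \<noteq> k0"
proof
  assume c: "cone 1 x \<in> nondegenerate ksusp"
  have "x \<noteq> k0"
    using c base_dim by (auto simp: susp_class_def base_simplex_def Base_nondegenerate)
  moreover have "x \<in> nondegenerate K"
    by (rule simplex_cases[OF x]) (use c in \<open>auto simp: cone_degen_degenerate simp del: One_nat_def\<close>)
  ultimately show "x \<in> nondegenerate K \<and> x \<noteq> k0" by simp
next
  assume nx: "x \<in> nondegenerate K \<and> x \<noteq> k0"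
  have "sdegen ksusp j u \<noteq> cone 1 x" if u: "u \<in> smp ksusp" "j \<le> sdim ksusp u" for j u
  proof (rule suspension_cases[OF u(1)])
    fix m assume "u = Base m"
    then show ?thesis using nx by (simp add: cone_nondegenerate_eq)
  next
    fix i y assume y: "1 \<le> i" "y \<in> smp K" "u = cone i y"
    show ?thesis
    proof (cases "j < i")
      case True
      then show ?thesis using y nx degen_cone_tip[of i j y]
        by (simp add: cone_nondegenerate_eq) (auto simp: susp_class_def)
    next
      case False
      then have le: "j - i \<le> sdim K y" using u y by (auto simp: dim_cone)
      then have "sdegen ksusp j u = cone i (sdegen K (j - i) y)"
        using degen_cone[OF y(1,2) le] False y by simp
      then show ?thesis
        using nx degen_not_nondegenerate[OF y(2) le] by (auto simp: cone_nondegenerate_eq) (auto simp: susp_class_def split: if_splits)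
    qed
  qed
  then show "cone 1 x \<in> nondegenerate ksusp" using x by (fastforce simp: nondegenerate_def)
qed

lemma word_apply_Base: "\<exists>k. word_apply ksusp w (Base m) = Base k"
proof (induction w)
  case (Cons s w)
  then show ?case by (cases s) auto
qed auto

lemma op_word_Base: "op_word n w m \<Longrightarrow> word_apply ksusp w (Base n) = Base m"
  using word_apply_Base[of w n] E.op_word_apply(2)[of n w m "Base n"] by fastforce

lemma back_Base: "p \<le> n \<Longrightarrow> word_apply ksusp (back_word p) (Base n) = Base (n - p)"
  by (intro op_word_Base op_word_back)

lemma front_Base: "p \<le> n \<Longrightarrow> word_apply ksusp (front_word n p) (Base n) = Base p"
  by (intro op_word_Base op_word_front)

lemma front_cone:
  assumes "1 \<le> a" "x \<in> smp K" "sdim K x = d" "j \<le> d"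
  shows "word_apply ksusp (front_word (a + d) (a + j)) (cone a x) = cone a (word_apply K (front_word d j) x)"
  using assms(4)
proof (induction j rule: inc_induct)
  case (step j)
  have "word_apply K (front_word d (Suc j)) x \<in> smp K"
    "sdim K (word_apply K (front_word d (Suc j)) x) = Suc j"
    using op_word_apply[OF op_word_front[of "Suc j" d]] assms step by auto
  then show ?case using step assms(1) by (simp add: front_word_less face_cone flip: add_Suc_right)
qed simp

lemma front_cone_tips:
  assumes "1 \<le> a" "x \<in> smp K" "sdim K x = d"
  shows "word_apply ksusp (front_word (a + d) (a - 1)) (cone a x) = Base (a - 1)"
proof -
  let ?v = "word_apply K (front_word d 0) x"
  have v: "?v \<in> smp K" "sdim K ?v = 0"
    using op_word_apply[OF op_word_front[of 0 d]] assms by auto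
  have "front_word (a + d) (a - 1) = Face a # front_word (a + d) a"
    using front_word_less[of "a - 1" "a + d"] assms(1) by simp
  then show ?thesis
    using face_cone[OF assms(1) v(1), of 0] v front_cone[OF assms, of 0] by simp
qed

lemma front_vertex:
  assumes "u \<in> smp ksusp"
  shows "word_apply ksusp (front_word (susp_dim K u) 0) u = Base 0"
proof -
  let ?v = "word_apply ksusp (front_word (susp_dim K u) 0) u"
  have v: "?v \<in> smp ksusp" "susp_dim K ?v = 0"
    using E.op_word_apply[OF op_word_front[of 0 "susp_dim K u"] assms] by auto
  show ?thesis by (rule suspension_cases[OF v(1)]) (use v(2) in \<open>auto simp: dim_cone\<close>)
qed

lemma back_cone:
  assumes "1 \<le> a" "x \<in> smp K" "p \<le> a + sdim K x"
  shows "word_apply ksusp (back_word p) (cone a x)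
    = (if p < a then cone (a - p) x else Base (a + sdim K x - p))"
  using assms(3)
proof (induction p)
  case 0
  then show ?case using assms by (simp add: back_word_def)
next
  case (Suc p)
  have "susp_face K k0 0 (cone (a - p) x) = (if a = Suc p then Base (sdim K x) else cone (a - Suc p) x)"
    if "p < a" using face_cone_tip[of "a - p" 0 x] that by auto
  then show ?case using Suc assms by (auto simp: back_word_def)
qed

section \<open>Pairs with a basepoint factor\<close>

text \<open>The factor \<open>Base m\<close> is degenerate at every index, so the pair is degenerate exactly where \<open>u\<close> is.\<close>

lemma pair_Base_nondegenerate:
  assumes "u \<in> smp ksusp" "susp_dim K u = m"
  shows "(u, Base m) \<in> nondegenerate (sset_prod ksusp ksusp) \<longleftrightarrow> u \<in> nondegenerate ksusp"
    and "(Base m, u) \<in> nondegenerate (sset_prod ksusp ksusp) \<longleftrightarrow> u \<in> nondegenerate ksusp"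
proof -
  { fix a i assume a: "a \<in> smp ksusp" "i \<le> susp_dim K a" "u = susp_degen K k0 i a"
    have "m = Suc (susp_dim K a)" using E.degen_dim[of a i] a assms by simp
    then have "(u, Base m) = sdegen (sset_prod ksusp ksusp) i (a, Base (susp_dim K a))"
      "(Base m, u) = sdegen (sset_prod ksusp ksusp) i (Base (susp_dim K a), a)"
      using a by auto
    then have "(u, Base m) \<notin> nondegenerate (sset_prod ksusp ksusp)"
      "(Base m, u) \<notin> nondegenerate (sset_prod ksusp ksusp)"
      using degen_not_nondegenerate[of "(a, Base (susp_dim K a))" "sset_prod ksusp ksusp" i]
        degen_not_nondegenerate[of "(Base (susp_dim K a), a)" "sset_prod ksusp ksusp" i] a by auto }
  note * = this
  have ex: "\<exists>a\<in>smp ksusp. \<exists>i\<le>susp_dim K a. u = susp_degen K k0 i a" if "u \<notin> nondegenerate ksusp"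
    using that assms(1) by (simp add: nondegenerate_def)
  have pair: "(u, Base m) \<in> smp (sset_prod ksusp ksusp)" "(Base m, u) \<in> smp (sset_prod ksusp ksusp)"
    using assms by auto
  show "(u, Base m) \<in> nondegenerate (sset_prod ksusp ksusp) \<longleftrightarrow> u \<in> nondegenerate ksusp"
  proof
    assume "u \<in> nondegenerate ksusp"
    then show "(u, Base m) \<in> nondegenerate (sset_prod ksusp ksusp)"
      using pair(1) by (auto simp: nondegenerate_def)
  qed (use * ex in blast)
  show "(Base m, u) \<in> nondegenerate (sset_prod ksusp ksusp) \<longleftrightarrow> u \<in> nondegenerate ksusp"
  proof
    assume "u \<in> nondegenerate ksusp"
    then show "(Base m, u) \<in> nondegenerate (sset_prod ksusp ksusp)"
      using pair(2) by (auto simp: nondegenerate_def)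
  qed (use * ex in blast)
qed

lemma outer_degens_pair_Base:
  assumes "(s, t) \<in> outer_degens m" "u \<in> smp ksusp" "susp_dim K u = m"
  shows "(word_apply ksusp s u, word_apply ksusp t (Base m)) \<notin> nondegenerate (sset_prod ksusp ksusp)"
    and "(word_apply ksusp s (Base m), word_apply ksusp t u) \<notin> nondegenerate (sset_prod ksusp ksusp)"
proof -
  have gen: "word_apply ksusp r u \<in> smp ksusp" "susp_dim K (word_apply ksusp r u) = Suc m"
    "word_apply ksusp r u \<notin> nondegenerate ksusp"
    if r0: "op_word m r (Suc m)" "\<exists>a r'. r = Degen a # r'" for r
  proof -
    obtain a r' where r1: "r = Degen a # r'" using r0(2) by auto
    then have r: "r = Degen a # r'" "op_word m r' m" "a \<le> m"
      using r0(1) by (auto elim!: op_word.cases[of m "Degen a # r'"])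
    then have "word_apply ksusp r' u \<in> smp ksusp" "susp_dim K (word_apply ksusp r' u) = m"
      using E.op_word_apply[OF r(2)] assms by auto
    then show "word_apply ksusp r u \<notin> nondegenerate ksusp"
      using degen_not_nondegenerate[of "word_apply ksusp r' u" ksusp a] r by simp
    show "word_apply ksusp r u \<in> smp ksusp" "susp_dim K (word_apply ksusp r u) = Suc m"
      using E.op_word_apply[OF r0(1)] assms by auto
  qed
  have s: "op_word m s (Suc m)" "\<exists>a r'. s = Degen a # r'"
    and t: "op_word m t (Suc m)" "\<exists>a r'. t = Degen a # r'"
    using assms(1) by (auto simp: outer_degens_def)
  show "(word_apply ksusp s u, word_apply ksusp t (Base m)) \<notin> nondegenerate (sset_prod ksusp ksusp)"
    using gen[OF s] pair_Base_nondegenerate(1) op_word_Base[OF t(1)] by simp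
  show "(word_apply ksusp s (Base m), word_apply ksusp t u) \<notin> nondegenerate (sset_prod ksusp ksusp)"
    using gen[OF t] pair_Base_nondegenerate(2) op_word_Base[OF s(1)] by simp
qed

text \<open>Both words of a term of \<open>\<phi>\<close> apply a degeneracy last, and the basepoint factor shares the
  degeneracy of the other one.\<close>

lemma F_map_Base_higher:
  assumes "2 \<le> k" "u \<in> smp ksusp" "susp_dim K u = m"
  shows "F_map ksusp k (frag_of (u, Base m)) = 0" "F_map ksusp k (frag_of (Base m, u)) = 0"
proof -
  have "F_split ksusp i j (word_apply ksusp s u, word_apply ksusp t (Base m)) = 0"
    "F_split ksusp i j (word_apply ksusp s (Base m), word_apply ksusp t u) = 0"
    if "(s, t) \<in> Poly_Mapping.keys (phi_ops m)" for s t i j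
    using outer_degens_pair_Base[OF subsetD[OF keys_phi_ops that] assms(2,3)] by (auto intro: F_split_0)
  then show "F_map ksusp k (frag_of (u, Base m)) = 0" "F_map ksusp k (frag_of (Base m, u)) = 0"
    unfolding F_map_rec[OF assms(1)]
    using assms(3) by (auto intro!: sum.neutral frag_extend_eq_0)
qed

text \<open>In the Alexander--Whitney sum the faces of the basepoint factor are degenerate unless they have
  dimension 0, which leaves one of the two extreme terms.\<close>

lemma F_map_Base_1:
  assumes "u \<in> smp ksusp" "susp_dim K u = m"
  shows "F_map ksusp 1 (frag_of (u, Base m))
      = (if u \<in> nondegenerate ksusp \<and> 0 < m then frag_of [(u, Base 0)] else 0)"
    and "F_map ksusp 1 (frag_of (Base m, u))
      = (if u \<in> nondegenerate ksusp \<and> 0 < m then frag_of [(Base 0, u)] else 0)"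
proof -
  have "alexander_whitney ksusp ksusp (frag_of (u, Base m))
      = (\<Sum>p=0..m. if p = m then (if u \<in> nondegenerate ksusp then frag_of (u, Base 0) else 0) else 0)"
    unfolding alexander_whitney_frag_of using assms
    by (intro sum.cong) (auto simp: back_Base Base_nondegenerate Let_def)
  then show "F_map ksusp 1 (frag_of (u, Base m))
      = (if u \<in> nondegenerate ksusp \<and> 0 < m then frag_of [(u, Base 0)] else 0)"
    using assms by (simp add: F_map_1)
  have "alexander_whitney ksusp ksusp (frag_of (Base m, u))
      = (\<Sum>p=0..m. if p = 0 then (if u \<in> nondegenerate ksusp then frag_of (Base 0, u) else 0) else 0)"
    unfolding alexander_whitney_frag_of using assms
    by (intro sum.cong) (auto simp: front_Base Base_nondegenerate Let_def back_word_def)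
  then show "F_map ksusp 1 (frag_of (Base m, u))
      = (if u \<in> nondegenerate ksusp \<and> 0 < m then frag_of [(Base 0, u)] else 0)"
    using assms by (simp add: F_map_1)
qed

lemma F_map_Base_0: "F_map ksusp k (frag_of (Base 0, Base 0)) = 0"
proof -
  consider "k = 0" | "k = 1" | "2 \<le> k" by linarith
  then show ?thesis
    using F_map_Base_1(1)[of "Base 0" 0] F_map_Base_higher(1)[of k "Base 0" 0]
    by cases (auto simp: F_map_0)
qed

section \<open>Cuts that contribute nothing\<close>

text \<open>Derived words preserve this property even when their indices are out of range, so it can be
  used without any bookkeeping of dimensions.\<close>

definition single_tip :: "'a susp \<Rightarrow> bool" where
  "single_tip u \<longleftrightarrow> (\<exists>m. u = Base m) \<or> (\<exists>x. u = Susp 1 x)"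

lemma single_tip_Base [simp]: "single_tip (Base m)"
  by (simp add: single_tip_def)

lemma single_tip_cone [simp]: "single_tip (cone (Suc 0) x)"
  by (auto simp: single_tip_def susp_class_def)

text \<open>All indices in a derived word are positive, so neither is the tip deleted nor a second one made.\<close>

lemma single_tip_derived:
  "single_tip u \<Longrightarrow> single_tip (word_apply ksusp (map sop_derived w) u)"
proof (induction w)
  case (Cons s w)
  then have "single_tip (word_apply ksusp (map sop_derived w) u)" by simp
  moreover have "single_tip (sop_apply ksusp (sop_derived s) v)" if "single_tip v" for v
    using that single_tip_cone by (cases s) (auto simp: single_tip_def[of v])
  ultimately show ?case by simp
qed auto

lemma single_tip_back:
  assumes "single_tip u" "1 \<le> p"
  shows "\<exists>m. word_apply ksusp (back_word p) u = Base m"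
proof -
  obtain q where q: "p = Suc q" using assms(2) by (cases p) auto
  have "\<exists>m. susp_face K k0 0 u = Base m" using assms(1) by (auto simp: single_tip_def)
  moreover have "back_word p = back_word q @ [Face 0]"
    by (simp add: back_word_def q replicate_append_same)
  ultimately show ?thesis using word_apply_Base by auto
qed

text \<open>The pair \<open>z \<times> w\<close> cut at its vertex \<open>p\<close>, which is the \<open>p\<close>-th term of the coproduct.\<close>

definition cut :: "nat \<Rightarrow> 'a susp \<times> 'a susp \<Rightarrow> ('a susp \<times> 'a susp) \<times> ('a susp \<times> 'a susp)" where
  "cut p = (\<lambda>(z, w).
     ((word_apply ksusp (front_word (susp_dim K z) p) z, word_apply ksusp (front_word (susp_dim K z) p) w),
      (word_apply ksusp (back_word p) z, word_apply ksusp (back_word p) w)))"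

definition cut_value :: "nat \<Rightarrow> nat \<Rightarrow> nat \<Rightarrow> 'a susp \<times> 'a susp \<Rightarrow> (('a susp \<times> 'a susp) list \<Rightarrow>\<^sub>0 int)" where
  "cut_value i j p zw = (case cut p zw of (a, b) \<Rightarrow>
     if a \<in> nondegenerate (sset_prod ksusp ksusp) \<and> b \<in> nondegenerate (sset_prod ksusp ksusp)
     then frag_cmul ((-1) ^ susp_dim K (fst a))
       (word_mult (F_map ksusp i (frag_of a)) (F_map ksusp j (frag_of b)))
     else 0)"

lemma F_split_cut:
  assumes "(z, w) \<in> nondegenerate (sset_prod ksusp ksusp)"
  shows "F_split ksusp i j (z, w) = (\<Sum>p=0..susp_dim K z. cut_value i j p (z, w))"
  unfolding F_split_nondegenerate[OF assms] by (simp add: cut_value_def cut_def Let_def cong: if_cong)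

text \<open>At \<open>p = 0\<close> the front half is the pair of basepoints of dimension 0, where every \<open>F\<close> is 0. At
  \<open>p \<ge> 1\<close> the back half of \<open>w\<close> is a basepoint, so the back half of the pair is nondegenerate only if
  the back face of \<open>z\<close> is; by assumption, it is then a pair of basepoints as well.\<close>

lemma cut_value_eq_0:
  assumes zw: "(z, w) \<in> nondegenerate (sset_prod ksusp ksusp)" and p: "p \<le> susp_dim K z"
    and w: "single_tip w"
    and z: "1 \<le> p \<Longrightarrow> word_apply ksusp (back_word p) z \<in> nondegenerate ksusp
        \<Longrightarrow> word_apply ksusp (back_word p) z = Base 0"
  shows "cut_value i j p (z, w) = 0"
proof (cases "p = 0")
  case True
  have zw': "z \<in> smp ksusp" "w \<in> smp ksusp" "susp_dim K z = susp_dim K w"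
    using nondegenerate_simplex[OF zw] by auto
  then have "word_apply ksusp (front_word (susp_dim K z) 0) w = Base 0"
    using front_vertex[of w] by simp
  then show ?thesis using front_vertex[OF zw'(1)] True
    by (simp add: cut_value_def cut_def F_map_Base_0)
next
  case False
  let ?b = "(word_apply ksusp (back_word p) z, word_apply ksusp (back_word p) w)"
  have "F_map ksusp j (frag_of ?b) = 0" if b: "?b \<in> nondegenerate (sset_prod ksusp ksusp)"
  proof -
    obtain m where m: "word_apply ksusp (back_word p) w = Base m"
      using single_tip_back[OF w, of p] False by auto
    have "word_apply ksusp (back_word p) z \<in> smp ksusp"
      "susp_dim K (word_apply ksusp (back_word p) z) = m"
      using nondegenerate_simplex[OF b] m by auto
    then have "word_apply ksusp (back_word p) z = Base 0" "m = 0"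
      using z b m pair_Base_nondegenerate(1) False by auto
    then show ?thesis by (simp add: m F_map_Base_0)
  qed
  then show ?thesis by (auto simp: cut_value_def cut_def)
qed

lemma F_split_eq_0:
  assumes "single_tip w"
    and "\<And>p. 1 \<le> p \<Longrightarrow> p \<le> susp_dim K z \<Longrightarrow> word_apply ksusp (back_word p) z \<in> nondegenerate ksusp
        \<Longrightarrow> word_apply ksusp (back_word p) z = Base 0"
  shows "F_split ksusp i j (z, w) = 0"
proof (cases "(z, w) \<in> nondegenerate (sset_prod ksusp ksusp)")
  case True
  then show ?thesis using assms
    by (auto simp: F_split_cut intro!: sum.neutral cut_value_eq_0)
qed (simp add: F_split_0)

text \<open>This disposes of the summand \<open>-\<phi>'\<close> in the recursion for \<open>\<phi>\<close>.\<close>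

lemma F_split_single_tip:
  assumes "single_tip z" "single_tip w"
  shows "F_split ksusp i j (z, w) = 0"
proof (rule F_split_eq_0[OF assms(2)])
  fix p :: nat assume p: "1 \<le> p" "word_apply ksusp (back_word p) z \<in> nondegenerate ksusp"
  obtain m where "word_apply ksusp (back_word p) z = Base m"
    using single_tip_back[OF assms(1) p(1)] by blast
  then show "word_apply ksusp (back_word p) z = Base 0" using p(2) by (simp add: Base_nondegenerate)
qed

text \<open>Simplices with a degeneracy in the direction of \<open>K\<close>. Deleting tips does not remove such a
  degeneracy, and further degeneracies cannot remove it either.\<close>

definition deep_degenerate :: "'a susp set" where
  "deep_degenerate = {cone a x | a x. 1 \<le> a \<and> x \<in> smp K \<and> x \<notin> nondegenerate K}"

lemma deep_degenerateI:
  "\<lbrakk>1 \<le> a; x \<in> smp K; j \<le> sdim K x\<rbrakk> \<Longrightarrow> cone a (sdegen K j x) \<in> deep_degenerate"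
  unfolding deep_degenerate_def using degen_closed[of x j] degen_not_nondegenerate[of x K j] by auto

lemma deep_degenerate_degens:
  assumes "op_word n r m" "set r \<subseteq> range Degen" "u \<in> deep_degenerate" "susp_dim K u = n"
  shows "word_apply ksusp r u \<in> deep_degenerate \<and> susp_dim K (word_apply ksusp r u) = m"
  using assms
proof (induction rule: op_word.induct)
  case (op_word_Degen r m i)
  then obtain a x where x: "1 \<le> a" "x \<in> smp K" "x \<notin> nondegenerate K"
    "word_apply ksusp r u = cone a x" "a + sdim K x = m"
    by (auto simp: deep_degenerate_def dim_cone)
  show ?case
  proof (cases "i < a")
    case True
    then show ?thesis using x degen_cone_tip[of a i x] unfolding deep_degenerate_def
      by (auto simp: dim_cone intro!: exI[of _ "Suc a"])
  next
    case False
    then have "susp_degen K k0 i (cone a x) = cone a (sdegen K (i - a) x)" "i - a \<le> sdim K x"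
      using degen_cone[of a x "i - a"] x op_word_Degen.hyps by auto
    then show ?thesis using x deep_degenerateI[of a x "i - a"] by (simp add: dim_cone degen_dim)
  qed
qed auto

lemma deep_degenerate_back:
  assumes "u \<in> deep_degenerate" "p \<le> susp_dim K u" "word_apply ksusp (back_word p) u \<in> nondegenerate ksusp"
  shows "word_apply ksusp (back_word p) u = Base 0"
proof -
  obtain a x where x: "1 \<le> a" "x \<in> smp K" "x \<notin> nondegenerate K" "u = cone a x"
    using assms(1) by (auto simp: deep_degenerate_def)
  obtain y j where y: "y \<in> smp K" "j \<le> sdim K y" "x = sdegen K j y"
    using x by (auto simp: nondegenerate_def)
  then have "cone i x \<notin> nondegenerate ksusp" if "1 \<le> i" for i
    using cone_degen_degenerate that by auto
  then show ?thesis using assms x by (auto simp: back_cone dim_cone Base_nondegenerate split: if_splits)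
qed

text \<open>Applied in increasing order, the degeneracies double tips as long as they form an initial segment
  of the admissible indices; the first gap makes the next one act on \<open>x\<close>. The bound on \<open>vs\<close> is
  what keeps every degeneracy within the dimension that is reached before it.\<close>

lemma degens_cone:
  assumes "sorted_wrt (<) vs" "\<forall>v\<in>set vs. a \<le> v + 2 \<and> v + 1 < a + sdim K x + length vs"
    "2 \<le> a" "x \<in> smp K"
  shows "if vs = [a - 2..<a - 2 + length vs]
    then word_apply ksusp (map sop_derived (map Degen (rev vs))) (cone a x) = cone (a + length vs) x
    else word_apply ksusp (map sop_derived (map Degen (rev vs))) (cone a x) \<in> deep_degenerate"
  using assms
proof (induction vs arbitrary: a)
  case (Cons v vs)
  show ?case
  proof (cases "v + 2 = a")
    case True
    have "v + 1 < a" using True by simp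
    then have tip: "susp_degen K k0 (v + 1) (cone a x) = cone (Suc a) x"
      using degen_cone_tip[of a "v + 1" x] Cons.prems by simp
    have iff: "v # vs = [a - 2..<a - 2 + length (v # vs)] \<longleftrightarrow> vs = [Suc a - 2..<Suc a - 2 + length vs]"
      using True by (auto simp: upt_conv_Cons simp del: upt_Suc)
    have "\<forall>u\<in>set vs. Suc a \<le> u + 2 \<and> u + 1 < Suc a + sdim K x + length vs"
      using Cons.prems True by auto
    from Cons.IH[OF _ this] show ?thesis
      unfolding iff using Cons.prems tip by (simp del: map_map)
  next
    case False
    then have le: "v + 1 - a \<le> sdim K x" "a \<le> v + 1"
    proof -
      show a: "a \<le> v + 1" using False Cons.prems by auto
      have "v + length vs < a + sdim K x + length vs"
      proof (cases "vs = []")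
        case True
        then show ?thesis using Cons.prems by auto
      next
        case False
        \<comment> \<open>The remaining indices are at least \<open>v + 1, v + 2, \<dots>\<close>, so the bound on the last one bounds \<open>v\<close>.\<close>
        have "vs ! i \<ge> v + i + 1" if "i < length vs" for i
          using that
        proof (induction i)
          case 0
          then have "vs ! 0 \<in> set vs" by simp
          then show ?case using Cons.prems(1) by (simp add: Suc_leI)
        next
          case (Suc i)
          then have "vs ! i < vs ! Suc i"
            using Cons.prems sorted_wrt_nth_less[of "(<)" vs i "Suc i"] by auto
          then show ?case using Suc by auto
        qed
        from this[of "length vs - 1"] False have "v + length vs \<le> last vs"
          by (simp add: last_conv_nth)
        moreover have "last vs + 1 < a + sdim K x + length (v # vs)"
          using Cons.prems False by auto
        ultimately show ?thesis by simp
      qed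
      then show "v + 1 - a \<le> sdim K x" using a by simp
    qed
    let ?u = "cone a (sdegen K (v + 1 - a) x)"
    have u: "?u \<in> deep_degenerate" "susp_dim K ?u = Suc (a + sdim K x)"
      using le Cons.prems by (auto simp: dim_cone degen_dim intro!: deep_degenerateI)
    have "op_word (a + sdim K x) (map Degen (rev vs)) (a + sdim K x + length vs)"
      using Cons.prems by (intro op_word_degen_list) auto
    from deep_degenerate_degens[OF op_word_derived[OF this] _ u]
    have "word_apply ksusp (map sop_derived (map Degen (rev vs))) ?u \<in> deep_degenerate"
      by auto
    moreover have "susp_degen K k0 (v + 1) (cone a x) = ?u"
      using degen_cone[of a x "v + 1 - a"] Cons.prems le by simp
    moreover have "v # vs \<noteq> [a - 2..<a - 2 + length (v # vs)]"
      using False Cons.prems(3) by (auto simp: upt_conv_Cons simp del: upt_Suc)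
    ultimately show ?thesis by simp
  qed
qed simp

section \<open>The diagonal simplex\<close>

text \<open>The first factor keeps the two tips of \<open>s\<^sub>0 e\<close>, since for \<open>i \<ge> 1\<close> the front face removes
  only vertices of \<open>x\<close>. Its degeneracies are the complement of \<open>M\<close>, an initial segment exactly if
  \<open>M\<close> is the final one.\<close>

lemma shuffle_word_first:
  assumes x: "x \<in> smp K" "sdim K x = n" and i: "1 \<le> i" "i \<le> Suc n"
    and M: "M \<in> shuffle_sets i (Suc n - i)"
  defines "z \<equiv> word_apply ksusp (fst (shuffle_word (Suc n) i M)) (cone 1 x)"
  shows "if M = {Suc n - i..<Suc n}
    then z = cone (Suc (Suc (Suc n - i))) (word_apply K (front_word n (i - 1)) x)
    else z \<in> deep_degenerate"
proof -
  let ?x = "word_apply K (front_word n (i - 1)) x"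
  let ?vs = "sorted_list_of_set ({..<Suc n} - M)"
  have x': "?x \<in> smp K" "sdim K ?x = i - 1"
    using op_word_apply[OF op_word_front[of "i - 1" n]] x i by auto
  have M': "M \<subseteq> {..<Suc n}" "card M = i" "finite M"
    using M i finite_subset by (auto simp: shuffle_sets_def)
  then have len: "length ?vs = Suc n - i" by (simp add: card_Diff_subset)
  have "map sop_derived (front_word (Suc n) i) = front_word (Suc (Suc n)) (Suc i)"
    by (simp add: front_word_def comp_def flip: map_Suc_upt del: upt_Suc)
  moreover have "word_apply ksusp (front_word (2 + n) (2 + (i - 1))) (cone 2 x) = cone 2 ?x"
    using i x by (intro front_cone) auto
  moreover have "susp_degen K k0 0 (cone 1 x) = cone 2 x"
    using degen_cone_tip[of 1 0 x] by (simp add: numeral_2_eq_2)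
  ultimately have z: "z = word_apply ksusp (map sop_derived (map Degen (rev ?vs))) (cone 2 ?x)"
    using i by (simp add: z_def shuffle_word_def degen_word_def del: map_map)
  have iff: "?vs = [2 - 2..<2 - 2 + length ?vs] \<longleftrightarrow> M = {Suc n - i..<Suc n}"
  proof
    assume "?vs = [2 - 2..<2 - 2 + length ?vs]"
    then have "set ?vs = set [2 - 2..<2 - 2 + (Suc n - i)]" unfolding len by (rule arg_cong)
    then have "{..<Suc n} - M = {0..<Suc n - i}" by simp
    then have "M = {..<Suc n} - {0..<Suc n - i}" using M' by blast
    then show "M = {Suc n - i..<Suc n}" by auto
  next
    assume "M = {Suc n - i..<Suc n}"
    then have "{..<Suc n} - M = {0..<Suc n - i}" by auto
    then have "?vs = [0..<Suc n - i]" by simp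
    then show "?vs = [2 - 2..<2 - 2 + length ?vs]" by simp
  qed
  have "\<forall>v\<in>set ?vs. 2 \<le> v + 2 \<and> v + 1 < 2 + sdim K ?x + length ?vs"
    unfolding len using x' i by auto
  then have "if ?vs = [2 - 2..<2 - 2 + length ?vs]
    then word_apply ksusp (map sop_derived (map Degen (rev ?vs))) (cone 2 ?x) = cone (2 + length ?vs) ?x
    else word_apply ksusp (map sop_derived (map Degen (rev ?vs))) (cone 2 ?x) \<in> deep_degenerate"
    using x' by (intro degens_cone) auto
  then show ?thesis unfolding iff unfolding len add_2_eq_Suc z .
qed

text \<open>The first derived back face \<open>\<partial>\<^sub>1\<close> removes the tip added by \<open>s\<^sub>0\<close>; the others remove vertices of \<open>x\<close>.\<close>

lemma shuffle_word_second:
  assumes x: "x \<in> smp K" "sdim K x = n" and i: "1 \<le> i" "i \<le> Suc n"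
  shows "word_apply ksusp (snd (shuffle_word (Suc n) i M)) (cone 1 x)
    = word_apply ksusp (map sop_derived (degen_word M)) (cone 1 (word_apply K (back_word (i - 1)) x))"
proof -
  have "word_apply ksusp (map sop_derived (back_word (Suc j))) (cone 2 x)
      = cone 1 (word_apply K (back_word j) x)" if "j \<le> n" for j
    using that
  proof (induction j)
    case 0
    then show ?case using face_cone_tip[of 2 1 x] by (simp add: back_word_def)
  next
    case (Suc j)
    let ?y = "word_apply K (back_word j) x"
    have "?y \<in> smp K" "sdim K ?y = n - j"
      using op_word_apply[OF op_word_back[of j n]] x Suc by auto
    then have "susp_face K k0 1 (cone 1 ?y) = cone 1 (sface K 0 ?y)"
      using face_cone[of 1 ?y 0] Suc by simp
    then show ?case using Suc by (simp add: back_word_def)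
  qed
  from this[of "i - 1"] show ?thesis
    using i degen_cone_tip[of 1 0 x] by (simp add: shuffle_word_def numeral_2_eq_2)
qed

text \<open>For the final shuffle the first factor is \<open>(p + 1, _)\<close> with \<open>p = n + 2 - i\<close>. Its back face \<open>\<partial>\<^sub>0\<^sup>q\<close> is
  nondegenerate of positive dimension only if it has exactly one tip, that is for \<open>q = p\<close>. There the
  front face of the first factor consists of tips, the front face of the second one undoes all its
  degeneracies, and the two values of \<open>F\<close> on pairs with a basepoint factor are known.\<close>

lemma F_split_shuffle_word:
  assumes x: "x \<in> smp K" "sdim K x = n" and i: "1 \<le> i" "i \<le> Suc n"
    and M: "M \<in> shuffle_sets i (Suc n - i)"
  defines "x' \<equiv> cone 1 (word_apply K (front_word n (i - 1)) x)"
    and "y' \<equiv> cone 1 (word_apply K (back_word (i - 1)) x)"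
  shows "F_split ksusp k l (word_apply ksusp (fst (shuffle_word (Suc n) i M)) (cone 1 x),
      word_apply ksusp (snd (shuffle_word (Suc n) i M)) (cone 1 x)) =
    (if M = {Suc n - i..<Suc n} \<and> k = 1 \<and> l = 1
        \<and> x' \<in> nondegenerate ksusp \<and> y' \<in> nondegenerate ksusp
     then frag_cmul ((-1) ^ Suc (Suc n - i)) (frag_of [(Base 0, y'), (x', Base 0)])
     else 0)"
proof -
  define z where "z = word_apply ksusp (fst (shuffle_word (Suc n) i M)) (cone 1 x)"
  define w where "w = word_apply ksusp (snd (shuffle_word (Suc n) i M)) (cone 1 x)"
  define p where "p = Suc (Suc n - i)"
  have e: "cone 1 x \<in> smp ksusp" "susp_dim K (cone 1 x) = Suc n"
    using x by (auto simp: dim_cone)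
  have "shuffle_word (Suc n) i M \<in> outer_degens (Suc n)"
    using shuffle_word_outer_degens M i by blast
  then have words: "op_word (Suc n) (fst (shuffle_word (Suc n) i M)) (Suc (Suc n))"
    "op_word (Suc n) (snd (shuffle_word (Suc n) i M)) (Suc (Suc n))"
    by (auto simp: outer_degens_def)
  have zw: "z \<in> smp ksusp" "susp_dim K z = Suc (Suc n)" "w \<in> smp ksusp" "susp_dim K w = Suc (Suc n)"
    using E.op_word_apply[OF words(1) e(1)] E.op_word_apply[OF words(2) e(1)] e(2)
    unfolding z_def w_def by auto
  have w: "w = word_apply ksusp (map sop_derived (degen_word M)) y'"
    using shuffle_word_second[OF x i] by (simp add: w_def y'_def)
  have tip: "single_tip w" unfolding w y'_def by (intro single_tip_derived) simp
  have x': "x' \<in> smp ksusp" "susp_dim K x' = i"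
    and y': "y' \<in> smp ksusp" "susp_dim K y' = p"
    using op_word_apply[OF op_word_front[of "i - 1" n]] op_word_apply[OF op_word_back[of "i - 1" n]] x i
    by (auto simp: x'_def y'_def dim_cone p_def)
  show ?thesis
  proof (cases "M = {Suc n - i..<Suc n}")
    case False
    then have "z \<in> deep_degenerate" using shuffle_word_first[OF x i M] by (simp add: z_def)
    then have "F_split ksusp k l (z, w) = 0"
      using tip deep_degenerate_back by (intro F_split_eq_0) auto
    then show ?thesis using False by (simp add: z_def w_def)
  next
    case True
    let ?v = "word_apply K (front_word n (i - 1)) x"
    have v: "?v \<in> smp K" "sdim K ?v = i - 1"
      using op_word_apply[OF op_word_front[of "i - 1" n]] x i by auto
    have z: "z = cone (Suc p) ?v"
      using shuffle_word_first[OF x i M] True by (simp add: z_def p_def)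
    have len: "Suc (Suc n) = p + i" using i by (simp add: p_def)
    have back_z: "word_apply ksusp (back_word q) z = (if q < Suc p then cone (Suc p - q) ?v else Base (Suc p + (i - 1) - q))"
      if "q \<le> Suc (Suc n)" for q
      using back_cone[of "Suc p" ?v q] v that len i by (simp add: z)
    have back_zp: "word_apply ksusp (back_word p) z = x'"
      using back_z[of p] len by (simp add: x'_def)
    have front_z: "word_apply ksusp (front_word (Suc (Suc n)) p) z = Base p"
      using front_cone_tips[of "Suc p" ?v "i - 1"] v len i by (simp add: z)
    have "map sop_derived (degen_word M) = map Degen (rev [p..<p + i])"
      unfolding True degen_word_def sorted_list_of_set_range
      using i by (simp add: p_def rev_map comp_def flip: map_Suc_upt del: upt_Suc)
    then have front_w: "word_apply ksusp (front_word (Suc (Suc n)) p) w = y'"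
      using E.front_degen_cancel[of y' p i] y' by (simp add: w len)
    have back_w: "word_apply ksusp (back_word p) w = Base i"
    proof -
      obtain m where m: "word_apply ksusp (back_word p) w = Base m"
        using single_tip_back[OF tip, of p] by (auto simp: p_def)
      then show ?thesis
        using E.op_word_apply(2)[OF op_word_back[of p "Suc (Suc n)"] zw(3)] zw(4) len by simp
    qed
    show ?thesis
    proof (cases "(z, w) \<in> nondegenerate (sset_prod ksusp ksusp)")
      case False
      then have "\<not> (x' \<in> nondegenerate ksusp \<and> y' \<in> nondegenerate ksusp)"
        using nondegenerate_prodI[OF simplicial_set_suspension simplicial_set_suspension, of z w "Suc (Suc n)" p]
          zw len back_zp front_w by auto
      then show ?thesis
        unfolding z_def[symmetric] w_def[symmetric] using False by (auto simp: F_split_0)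
    next
      case nd: True
      have "cut_value k l q (z, w) = 0" if q: "q \<le> Suc (Suc n)" "q \<noteq> p" for q
      proof (rule cut_value_eq_0[OF nd _ tip])
        show "q \<le> susp_dim K z" using q zw by simp
        assume "1 \<le> q" "word_apply ksusp (back_word q) z \<in> nondegenerate ksusp"
        then show "word_apply ksusp (back_word q) z = Base 0"
          using back_z[OF q(1)] cone_degenerate[OF v(1), of "Suc p - q"] q(2)
          by (auto simp: Base_nondegenerate split: if_splits)
      qed
      then have "F_split ksusp k l (z, w) = (\<Sum>q=0..Suc (Suc n). if q = p then cut_value k l p (z, w) else 0)"
        unfolding F_split_cut[OF nd] zw(2) by (intro sum.cong) auto
      also have "\<dots> = cut_value k l p (z, w)" using len by simp
      also have "cut p (z, w) = ((Base p, y'), (x', Base i))"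
        using zw back_zp back_w front_z front_w by (simp add: cut_def)
      then have "cut_value k l p (z, w) = (if y' \<in> nondegenerate ksusp \<and> x' \<in> nondegenerate ksusp
          then frag_cmul ((-1) ^ p) (word_mult (F_map ksusp k (frag_of (Base p, y')))
            (F_map ksusp l (frag_of (x', Base i)))) else 0)"
        using pair_Base_nondegenerate(2)[OF y'] pair_Base_nondegenerate(1)[OF x']
        by (simp add: cut_value_def)
      also have "\<dots> = (if k = 1 \<and> l = 1 \<and> x' \<in> nondegenerate ksusp \<and> y' \<in> nondegenerate ksusp
          then frag_cmul ((-1) ^ p) (frag_of [(Base 0, y'), (x', Base 0)]) else 0)"
      proof -
        consider "k = 0 \<or> l = 0" | "2 \<le> k \<or> 2 \<le> l" | "k = 1" "l = 1" by linarith
        then show ?thesis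
        proof cases
          case 3
          then show ?thesis
            using F_map_Base_1(2)[OF y'] F_map_Base_1(1)[OF x'] i by (simp add: p_def)
        qed (use F_map_Base_higher(2)[OF _ y'] F_map_Base_higher(1)[OF _ x'] in \<open>auto simp: F_map_0\<close>)
      qed
      finally show ?thesis using True by (simp add: z_def w_def p_def)
    qed
  qed
qed

text \<open>For \<open>i = 0\<close> the front face of the first factor consists of tips only, and \<open>s\<^sub>0\<close> survives in the
  second factor; so \<open>s\<^sub>0\<close> is common to both.\<close>

lemma F_split_shuffle_word_0:
  assumes x: "x \<in> smp K" "sdim K x = n" and M: "M \<in> shuffle_sets 0 (Suc n)"
  shows "F_split ksusp k l (word_apply ksusp (fst (shuffle_word (Suc n) 0 M)) (cone 1 x),
      word_apply ksusp (snd (shuffle_word (Suc n) 0 M)) (cone 1 x)) = 0"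
proof (rule F_split_0)
  have M: "M = {}" using M finite_subset[of M "{..<Suc n}"] by (auto simp: shuffle_sets_def)
  have up: "susp_degen K k0 0 (cone 1 x) = cone 2 x"
    using degen_cone_tip[of 1 0 x] by (simp add: numeral_2_eq_2)
  let ?z = "word_apply ksusp (fst (shuffle_word (Suc n) 0 M)) (cone 1 x)"
  have "map sop_derived (front_word (Suc n) 0) = front_word (2 + n) (2 - 1)"
    by (simp add: front_word_def comp_def flip: map_Suc_upt del: upt_Suc)
  moreover have "word_apply ksusp (front_word (2 + n) (2 - 1)) (cone 2 x) = Base (2 - 1)"
    using x by (intro front_cone_tips) auto
  ultimately have "\<exists>k. ?z = Base k" using up word_apply_Base by (simp add: shuffle_word_def)
  moreover have "shuffle_word (Suc n) 0 M \<in> outer_degens (Suc n)"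
    using shuffle_word_outer_degens assms(3) by force
  then have "op_word (Suc n) (fst (shuffle_word (Suc n) 0 M)) (Suc (Suc n))"
    by (auto simp: outer_degens_def)
  from E.op_word_apply(2)[OF this, of "cone 1 x"] have "susp_dim K ?z = Suc (Suc n)"
    using x by (simp add: dim_cone)
  ultimately have z: "?z = Base (Suc (Suc n))" by auto
  have w: "word_apply ksusp (snd (shuffle_word (Suc n) 0 M)) (cone 1 x) = cone 2 x"
    using up by (simp add: shuffle_word_def M back_word_def)
  show "(?z, word_apply ksusp (snd (shuffle_word (Suc n) 0 M)) (cone 1 x))
      \<notin> nondegenerate (sset_prod ksusp ksusp)"
    unfolding z w using pair_Base_nondegenerate(2)[of "cone 2 x" "Suc (Suc n)"] cone_degenerate[of x 2] x
    by (simp add: dim_cone)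
qed

text \<open>The whole sum over \<open>\<phi>(e \<times> e)\<close>, reindexed like the coproduct of \<open>x\<close>: the \<open>i\<close>-th term comes from
  the summand \<open>i + 1\<close> of \<open>f\<close>, as the summand 0 vanishes. The exponent is \<open>\<epsilon>(\<mu>) = (i + 1) (n - i)\<close>
  plus the dimension \<open>n - i + 1\<close> of the front half of the cut.\<close>

lemma frag_extend_F_split_phi:
  assumes x: "x \<in> smp K" "sdim K x = n"
  defines "x' \<equiv> \<lambda>i. cone 1 (word_apply K (front_word n i) x)"
    and "y' \<equiv> \<lambda>i. cone 1 (word_apply K (back_word i) x)"
  shows "frag_extend (\<lambda>(u, v). F_split ksusp k l (word_apply ksusp u (cone 1 x), word_apply ksusp v (cone 1 x)))
      (phi_ops (Suc n)) =
    (if k = 1 \<and> l = 1 then (\<Sum>i=0..n.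
      if x' i \<in> nondegenerate ksusp \<and> y' i \<in> nondegenerate ksusp
      then frag_cmul ((-1) ^ (Suc i * (n - i) + Suc (n - i))) (frag_of [(Base 0, y' i), (x' i, Base 0)])
      else 0) else 0)"
proof -
  let ?G = "\<lambda>(u, v). F_split ksusp k l (word_apply ksusp u (cone 1 x), word_apply ksusp v (cone 1 x))"
  let ?V = "\<lambda>i. if k = 1 \<and> l = 1 \<and> x' i \<in> nondegenerate ksusp \<and> y' i \<in> nondegenerate ksusp
      then frag_cmul ((-1) ^ (Suc i * (n - i) + Suc (n - i))) (frag_of [(Base 0, y' i), (x' i, Base 0)])
      else 0"
  have G: "?G p = F_split ksusp k l
      (word_apply ksusp (fst p) (cone 1 x), word_apply ksusp (snd p) (cone 1 x))" for p
    by (simp add: split_def)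
  have "frag_extend ?G (derived (phi_ops n)) = 0"
    unfolding derived_def frag_extend_frag_extend
    by (auto intro!: frag_extend_eq_0 F_split_single_tip single_tip_derived)
  then have "frag_extend ?G (phi_ops (Suc n)) = (\<Sum>i=0..Suc n. \<Sum>M\<in>shuffle_sets i (Suc n - i).
      frag_cmul ((-1) ^ shuffle_eps M) (?G (shuffle_word (Suc n) i M)))"
    unfolding phi_ops_Suc_expand
    by (simp add: frag_extend_diff frag_extend_sum finite_shuffle_sets frag_extend_cmul
        comp_def del: sum.cl_ivl_Suc)
  also have "\<dots> = (\<Sum>i=0..Suc n. case i of 0 \<Rightarrow> 0 | Suc j \<Rightarrow> ?V j)"
  proof (intro sum.cong refl)
    fix i assume i: "i \<in> {0..Suc n}"
    show "(\<Sum>M\<in>shuffle_sets i (Suc n - i). frag_cmul ((-1) ^ shuffle_eps M) (?G (shuffle_word (Suc n) i M)))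
      = (case i of 0 \<Rightarrow> 0 | Suc j \<Rightarrow> ?V j)"
    proof (cases i)
      case 0
      then show ?thesis using F_split_shuffle_word_0[OF x] unfolding G
        by (auto intro!: sum.neutral)
    next
      case (Suc j)
      let ?M = "{Suc n - i..<Suc n}"
      have "?M \<in> shuffle_sets i (Suc n - i)" using i by (auto simp: shuffle_sets_def)
      moreover have "?M = {n - j..<n - j + Suc j}" using i Suc by auto
      then have eps: "shuffle_eps ?M = Suc j * (n - j)" by (simp only: shuffle_eps_segment)
      have "frag_cmul ((-1) ^ shuffle_eps M) (?G (shuffle_word (Suc n) i M)) = (if M = ?M then ?V j else 0)"
        if "M \<in> shuffle_sets i (Suc n - i)" for M
        unfolding G using F_split_shuffle_word[OF x _ _ that, of k l] i eps Suc
        by (auto simp: x'_def y'_def simp flip: power_add)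
      ultimately show ?thesis using Suc by (simp add: finite_shuffle_sets)
    qed
  qed
  also have "\<dots> = (\<Sum>j=0..n. ?V j)"
    by (subst sum.atLeast0_atMost_Suc_shift) simp
  finally show ?thesis by (auto intro: sum.cong)
qed

lemma F_map_diag:
  assumes x: "x \<in> smp K" "sdim K x = n"
  defines "x' \<equiv> \<lambda>i. cone 1 (word_apply K (front_word n i) x)"
    and "y' \<equiv> \<lambda>i. cone 1 (word_apply K (back_word i) x)"
  shows "F_map ksusp 2 (frag_of (cone 1 x, cone 1 x)) = (\<Sum>i=0..n.
      if x' i \<in> nondegenerate ksusp \<and> y' i \<in> nondegenerate ksusp
      then frag_cmul ((-1) ^ (Suc i * (n - i) + (n - i))) (frag_of [(Base 0, y' i), (x' i, Base 0)])
      else 0)"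
    and "3 \<le> k \<Longrightarrow> F_map ksusp k (frag_of (cone 1 x, cone 1 x)) = 0"
proof -
  have d: "sdim ksusp (cone 1 x) = Suc n" using x by (simp add: dim_cone)
  have two: "{1..<2::nat} = {1}" "2 - (1::nat) = 1" by auto
  have "F_map ksusp 2 (frag_of (cone 1 x, cone 1 x)) = - (\<Sum>i=0..n.
      if x' i \<in> nondegenerate ksusp \<and> y' i \<in> nondegenerate ksusp
      then frag_cmul ((-1) ^ (Suc i * (n - i) + Suc (n - i))) (frag_of [(Base 0, y' i), (x' i, Base 0)])
      else 0)"
    unfolding F_map_rec[OF order.refl] d frag_extend_F_split_phi[OF x] two x'_def y'_def
    by (simp only: two sum.insert sum.empty finite.emptyI empty_iff add_0_right if_True simp_thms)
  also have "\<dots> = (\<Sum>i=0..n. - (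
      if x' i \<in> nondegenerate ksusp \<and> y' i \<in> nondegenerate ksusp
      then frag_cmul ((-1) ^ (Suc i * (n - i) + Suc (n - i))) (frag_of [(Base 0, y' i), (x' i, Base 0)])
      else 0))"
    by (rule sum_negf[symmetric])
  also have "\<dots> = (\<Sum>i=0..n.
      if x' i \<in> nondegenerate ksusp \<and> y' i \<in> nondegenerate ksusp
      then frag_cmul ((-1) ^ (Suc i * (n - i) + (n - i))) (frag_of [(Base 0, y' i), (x' i, Base 0)])
      else 0)"
    by (intro sum.cong) simp_all
  finally show "F_map ksusp 2 (frag_of (cone 1 x, cone 1 x)) = (\<Sum>i=0..n.
      if x' i \<in> nondegenerate ksusp \<and> y' i \<in> nondegenerate ksusp
      then frag_cmul ((-1) ^ (Suc i * (n - i) + (n - i))) (frag_of [(Base 0, y' i), (x' i, Base 0)])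
      else 0)" .
  show "F_map ksusp k (frag_of (cone 1 x, cone 1 x)) = 0" if "3 \<le> k"
  proof -
    have "2 \<le> k" using that by simp
    moreover have "\<not> (i = 1 \<and> k - i = 1)" for i using that by auto
    ultimately show ?thesis
      by (simp only: F_map_rec d frag_extend_F_split_phi[OF x] if_False sum.neutral_const minus_zero)
  qed
qed

lemma F_map_diag_1:
  assumes x: "x \<in> nondegenerate K" "x \<noteq> k0"
  shows "F_map ksusp 1 (frag_of (cone 1 x, cone 1 x)) = frag_of [(Base 0, cone 1 x)] + frag_of [(cone 1 x, Base 0)]"
proof -
  let ?e = "cone 1 x" and ?N = "Suc (sdim K x)"
  have xs: "x \<in> smp K" using x by (simp add: nondegenerate_def)
  have e: "?e \<in> nondegenerate ksusp" "susp_dim K ?e = ?N" "?e \<in> smp ksusp"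
    using cone_1_nondegenerate[OF xs] x xs by (auto simp: dim_cone)
  have bck: "word_apply ksusp (back_word p) ?e = Base (?N - p)" if "1 \<le> p" "p \<le> ?N" for p
    using back_cone[of 1 x p] xs that by simp
  let ?f = "\<lambda>p. let a = word_apply ksusp (front_word ?N p) ?e; b = word_apply ksusp (back_word p) ?e
     in if a \<in> nondegenerate ksusp \<and> b \<in> nondegenerate ksusp then frag_of (a, b) else 0"
  have "alexander_whitney ksusp ksusp (frag_of (?e, ?e)) = (\<Sum>p=0..?N. ?f p)"
    unfolding alexander_whitney_frag_of using e by simp
  also have "\<dots> = (\<Sum>p\<in>{0, ?N}. ?f p)"
    using bck by (intro sum.mono_neutral_right) (auto simp: Base_nondegenerate Let_def)
  also have "\<dots> = frag_of (Base 0, ?e) + frag_of (?e, Base 0)"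
    using front_vertex[OF e(3)] e bck[of ?N] by (simp add: Base_nondegenerate back_word_def[of 0])
  finally show ?thesis using e by (simp add: F_map_1 frag_extend_add)
qed

lemma xi_cone:
  assumes x: "x \<in> nondegenerate K" "x \<noteq> k0" "sdim K x = n"
  defines "x' \<equiv> \<lambda>i. cone 1 (word_apply K (front_word n i) x)"
    and "y' \<equiv> \<lambda>i. cone 1 (word_apply K (back_word i) x)"
  shows "xi K k0 (frag_of (cone 1 x)) = frag_of ([], [cone 1 x]) + frag_of ([cone 1 x], [])
     + (\<Sum>i=0..n. if x' i \<in> nondegenerate ksusp \<and> y' i \<in> nondegenerate ksusp
          then frag_of ([x' i], [y' i]) else 0)"
proof -
  let ?e = "cone 1 x" and ?d = "frag_of (cone 1 x, cone 1 x)"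
  have xs: "x \<in> smp K" using x by (simp add: nondegenerate_def)
  have e: "?e \<in> nondegenerate ksusp" using cone_1_nondegenerate[OF xs] x by simp
  then have "(?e, ?e) \<in> nondegenerate (sset_prod ksusp ksusp)"
    by (auto simp: nondegenerate_def)
  then have d: "chain_diag ksusp (frag_of ?e) = ?d"
    by (simp add: chain_diag_def normalize_frag_of)
  have "F_map ksusp k ?d = 0" if "1 \<le> k" "k \<notin> {1, 2}" for k
    using F_map_diag(2)[OF xs x(3), of k] that by simp
  then have sum12: "(\<Sum>k\<in>{k. 1 \<le> k \<and> F_map ksusp k ?d \<noteq> 0}. F_map ksusp k ?d) = (\<Sum>k\<in>{1, 2}. F_map ksusp k ?d)"
    by (intro sum.mono_neutral_left) auto
  have "xi K k0 (frag_of ?e) = milgram ksusp (Base 0) (F_map ksusp 1 ?d + F_map ksusp 2 ?d)"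
    unfolding xi_def Let_def d sum12 by simp
  also have "\<dots> = milgram ksusp (Base 0) (F_map ksusp 1 ?d) + milgram ksusp (Base 0) (F_map ksusp 2 ?d)"
    by (simp add: milgram_def algebra_map_def frag_extend_add)
  also have "milgram ksusp (Base 0) (F_map ksusp 1 ?d) = frag_of ([], [?e]) + frag_of ([?e], [])"
  proof -
    have "?e \<noteq> Base 0" using x by (simp add: cone_nondegenerate_eq)
    then show ?thesis unfolding F_map_diag_1[OF x(1,2)]
      by (simp add: milgram_def algebra_map_def frag_extend_add)
  qed
  also have "milgram ksusp (Base 0) (F_map ksusp 2 ?d)
    = (\<Sum>i=0..n. if x' i \<in> nondegenerate ksusp \<and> y' i \<in> nondegenerate ksusp
          then frag_of ([x' i], [y' i]) else 0)"
  proof -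
    have "milgram ksusp (Base 0) (frag_cmul ((-1) ^ (Suc i * (n - i) + (n - i))) (frag_of [(Base 0, y' i), (x' i, Base 0)]))
        = frag_of ([x' i], [y' i])" if i: "i \<le> n" "y' i \<in> nondegenerate ksusp" for i
    proof -
      have ne: "y' i \<noteq> Base 0"
        using op_word_apply[OF op_word_back[of i n]] xs x(3) i
          dim_cone[of 1 "word_apply K (back_word i) x"] by (auto simp: y'_def)
      have dims: "susp_dim K (x' i) - 1 = i" "susp_dim K (y' i) - 1 = n - i"
        using op_word_apply[OF op_word_back[of i n]] op_word_apply[OF op_word_front[of i n]] xs x(3) i
        by (auto simp: x'_def y'_def dim_cone)
      \<comment> \<open>Shuffle sign and recursion sign together are \<open>(i + 1) m + m\<close> with \<open>m = n - i\<close>; the Koszul sign of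
        exchanging \<open>[y' i]\<close> and \<open>[x' i]\<close> contributes \<open>m * i\<close>.\<close>
      have "Suc i * m + m + m * i = 2 * (Suc i * m)" for m by (simp add: algebra_simps)
      then have "even (Suc i * (n - i) + (n - i) + (n - i) * i)" by (metis dvd_triv_left)
      then have "(-1 :: int) ^ (Suc i * (n - i) + (n - i)) * (-1) ^ ((n - i) * i) = 1"
        by (metis power_add neg_one_even_power)
      then show ?thesis using ne dims
        by (simp add: milgram_def algebra_map_def frag_extend_cmul cobar2_mult_frag_of del: power_Suc)
    qed
    note milgram_term = this
    have "milgram ksusp (Base 0) (F_map ksusp 2 ?d) = (\<Sum>i=0..n. milgram ksusp (Base 0)
      (if x' i \<in> nondegenerate ksusp \<and> y' i \<in> nondegenerate ksusp
      then frag_cmul ((-1) ^ (Suc i * (n - i) + (n - i))) (frag_of [(Base 0, y' i), (x' i, Base 0)])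
      else 0))"
      unfolding F_map_diag(1)[OF xs x(3)] x'_def y'_def
      by (simp only: milgram_def algebra_map_def frag_extend_sum[OF finite_atLeastAtMost] comp_def)
    also have "\<dots> = (\<Sum>i=0..n. if x' i \<in> nondegenerate ksusp \<and> y' i \<in> nondegenerate ksusp
          then frag_of ([x' i], [y' i]) else 0)"
      using milgram_term by (intro sum.cong) (auto simp: milgram_def algebra_map_def)
    finally show ?thesis .
  qed
  finally show ?thesis .
qed

section \<open>The map alpha\<close>

text \<open>This form has no case distinction on \<open>y = k0\<close> or on degenerate \<open>y\<close>: in both cases the letter
  \<open>(1, y)\<close> is degenerate. The extra \<open>[]\<close> on vertices is the unit part of \<open>\<alpha>(y) = \<alpha>(y - k0) + \<alpha>(k0)\<close>.\<close>

lemma alpha_normalize: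
  assumes "y \<in> smp K"
  shows "alpha K k0 (normalize K (frag_of y))
    = (if cone 1 y \<in> nondegenerate ksusp then frag_of [cone 1 y] else 0)
      + (if sdim K y = 0 then frag_of [] else 0)"
proof -
  have "y \<in> nondegenerate K" if "sdim K y = 0"
    using that assms degen_dim by (fastforce simp: nondegenerate_def)
  then show ?thesis using cone_1_nondegenerate[OF assms] base_dim
    by (auto simp: alpha_def normalize_frag_of)
qed

lemma alpha_frag_of:
  assumes "x \<in> nondegenerate K"
  shows "alpha K k0 (frag_of x) = (if x = k0 then 0 else frag_of [cone 1 x])
      + (if sdim K x = 0 then frag_of [] else 0)"
  using base_dim by (simp add: alpha_def)

lemma alpha_coproduct:
  assumes x: "x \<in> nondegenerate K"
  shows "tens_map (alpha K k0) (alpha K k0) (coproduct K (frag_of x)) = psi K k0 (alpha K k0 (frag_of x))"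
proof -
  define n where "n = sdim K x"
  have xs: "x \<in> smp K" using x by (simp add: nondegenerate_def)
  define A where "A = (\<lambda>y. if cone 1 y \<in> nondegenerate ksusp then frag_of [cone 1 y] else 0)"
  let ?f = "\<lambda>i. word_apply K (front_word n i) x" and ?b = "\<lambda>i. word_apply K (back_word i) x"
  have fb: "?f i \<in> smp K" "sdim K (?f i) = i" "?b i \<in> smp K" "sdim K (?b i) = n - i" if "i \<le> n" for i
    using op_word_apply[OF op_word_back[of i n]] op_word_apply[OF op_word_front[of i n]] xs that
    by (auto simp: n_def)
  have tm: "tens_map (alpha K k0) (alpha K k0) (tens (normalize K (frag_of a)) (normalize K (frag_of b)))
     = tens (alpha K k0 (normalize K (frag_of a))) (alpha K k0 (normalize K (frag_of b)))" for a b
    by (simp add: normalize_frag_of tens_map_tens) (simp add: tens_map_def alpha_def)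
  have "tens_map (alpha K k0) (alpha K k0) (coproduct K (frag_of x))
    = (\<Sum>i=0..n. tens (alpha K k0 (normalize K (frag_of (?f i)))) (alpha K k0 (normalize K (frag_of (?b i)))))"
    unfolding tm[symmetric] unfolding coproduct_def n_def[symmetric]
    by (simp add: tens_map_def frag_extend_sum comp_def n_def del: sum.cl_ivl_Suc)
  \<comment> \<open>The front face is a vertex for \<open>i = 0\<close> and the back face is one for \<open>i = n\<close>; these are the terms in
    which the unit part of \<open>\<alpha>\<close> enters.\<close>
  also have "\<dots> = (\<Sum>i=0..n. tens (A (?f i)) (A (?b i))
      + (if i = 0 then tens (frag_of []) (A (?b i)) else 0) + (if i = n then tens (A (?f i)) (frag_of []) else 0)
      + (if i = 0 then if n = 0 then frag_of ([], []) else 0 else 0))"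
    using fb by (intro sum.cong) (auto simp: alpha_normalize A_def tens_add)
  also have "\<dots> = (\<Sum>i=0..n. tens (A (?f i)) (A (?b i))) + tens (frag_of []) (A x) + tens (A x) (frag_of [])
      + (if n = 0 then frag_of ([], []) else 0)"
    by (simp add: sum.distrib back_word_def del: sum.cl_ivl_Suc)
  also have "\<dots> = psi K k0 (alpha K k0 (frag_of x))"
  proof (cases "x = k0")
    case True
    then have "A x = 0" "n = 0" "psi K k0 (alpha K k0 (frag_of x)) = frag_of ([], [])"
      using cone_1_nondegenerate[OF xs] base_dim
      by (auto simp: A_def n_def alpha_def psi_def algebra_map_Nil)
    then show ?thesis by (simp add: back_word_def)
  next
    case False
    have Ax: "A x = frag_of [cone 1 x]" using cone_1_nondegenerate[OF xs] False x by (simp add: A_def)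
    have "psi K k0 (alpha K k0 (frag_of x)) = xi K k0 (frag_of (cone 1 x)) + (if n = 0 then frag_of ([], []) else 0)"
      using False by (simp add: alpha_frag_of[OF x] n_def psi_def algebra_map_def frag_extend_add)
    moreover have "(\<Sum>i=0..n. tens (A (?f i)) (A (?b i))) =
      (\<Sum>i=0..n. if cone 1 (?f i) \<in> nondegenerate ksusp \<and> cone 1 (?b i) \<in> nondegenerate ksusp
          then frag_of ([cone 1 (?f i)], [cone 1 (?b i)]) else 0)"
      by (intro sum.cong) (auto simp: A_def)
    ultimately show ?thesis
      unfolding xi_cone[OF x False n_def[symmetric]] Ax by (simp add: add_ac)
  qed
  finally show ?thesis .
qed

end

theorem corollary4p8:
  fixes K :: "'a sset" and k0 :: 'a
  assumes "pointed_simplicial_set K k0"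
  shows "\<forall>c\<in>normalized_chains K.
           alpha K k0 c \<in> cobar (suspension K k0) \<and>
           cobar_aug (alpha K k0 c) = chain_aug K c \<and>
           tens_map (alpha K k0) (alpha K k0) (coproduct K c) = psi K k0 (alpha K k0 c)"
proof
  interpret pointed_simplicial_set K k0 by fact
  fix c assume "c \<in> normalized_chains K"
  then have "Poly_Mapping.keys c \<subseteq> nondegenerate K" by (simp add: normalized_chains_def)
  then show "alpha K k0 c \<in> cobar (suspension K k0) \<and>
           cobar_aug (alpha K k0 c) = chain_aug K c \<and>
           tens_map (alpha K k0) (alpha K k0) (coproduct K c) = psi K k0 (alpha K k0 c)"
  proof (induction c rule: frag_induction)
    case zero
    show ?case
      by (simp add: alpha_def cobar_def cobar_aug_def chain_aug_def coproduct_def tens_map_def psi_def algebra_map_def)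
  next
    case (one x)
    have "x \<in> smp K" using one by (simp add: nondegenerate_def)
    then have "x \<noteq> k0 \<longrightarrow> cone 1 x \<in> nondegenerate ksusp" using one cone_1_nondegenerate by blast
    moreover have "0 < susp_dim K (cone 1 x)" by (simp add: dim_cone)
    ultimately have "alpha K k0 (frag_of x) \<in> cobar ksusp"
      unfolding alpha_frag_of[OF one] cobar_def
      by (auto simp: keys_frag_of dest!: subsetD[OF keys_add])
    moreover have "cobar_aug (alpha K k0 (frag_of x)) = chain_aug K (frag_of x)"
      unfolding alpha_frag_of[OF one]
      using base_dim by (simp add: cobar_aug_def chain_aug_def keys_frag_of lookup_add lookup_single)
    ultimately show ?case using alpha_coproduct[OF one] by blast
  next
    case (diff a b)
    have lin: "alpha K k0 (a - b) = alpha K k0 a - alpha K k0 b"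
      by (simp add: alpha_def frag_extend_diff)
    have "alpha K k0 (a - b) \<in> cobar ksusp"
      using diff unfolding lin cobar_def by (auto dest!: subsetD[OF keys_diff])
    moreover have "cobar_aug (alpha K k0 (a - b)) = chain_aug K (a - b)"
      using diff by (simp add: lin cobar_aug_def chain_aug_diff lookup_minus)
    moreover have "tens_map (alpha K k0) (alpha K k0) (coproduct K (a - b)) = psi K k0 (alpha K k0 (a - b))"
      using diff unfolding lin by (simp add: tens_map_def coproduct_def psi_def algebra_map_def frag_extend_diff)
    ultimately show ?case by blast
  qed
qed

end
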